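(* Let $\mathcal{L}$ be a relational language and let $\mathcal{K}$ be a class of finite $\mathcal{L}$-structures satisfying HP, JEP, bAP, PP and CP. Then $\mathcal{K}$ is a Fraïssé class, and its limit $\mathfrak{M}$ is ultrahomogeneous (and therefore an exact limit of $\mathcal{K}$), in addition to being universal for separable $\mathcal{K}$-structures (every separable $\mathcal{K}$-structure embeds into $\mathfrak{M}$). Moreover, up to isomorphism, $\mathfrak{M}$ is the unique separable $\mathcal{K}$-structure that is ultrahomogeneous and universal for separable $\mathcal{K}$-structures.
   Context: **Structures.** $\mathcal{L}$ is a collection of predicate symbols, each with a finite arity, with finitely many symbols of each arity, including a distinguished binary symbol $d$. An $\mathcal{L}$-structure $\mathfrak{A}$ is a complete metric space $(A,d)$ together with, for each $n$-ary $R\in\mathcal{L}$, a uniformly continuous function $R^{\mathfrak{A}}\colon A^n\to\mathbb{R}$ (the symbol $d$ being interpreted by the metric). An embedding $\phi\colon\mathfrak{A}\to\mathfrak{B}$ is a map $\phi\colon A\to B$ with $R^{\mathfrak{B}}(\phi(\bar a))=R^{\mathfrak{A}}(\bar a)$ for all $n$-ary $R\in\mathcal{L}$ and $\bar a\in A^n$ (so embeddings are isometric). $\mathfrak{A}$ is a substructure of $\mathfrak{B}$ if there is an embedding $\mathfrak{A}\to\mathfrak{B}$. An isomorphism is a surjective embedding; an automorphism is an isomorphism from a structure to itself. A finite partial isomorphism of $\mathfrak{M}$ is an embedding $A_0\to M$ with $A_0\subseteq M$ finite. A separable structure $\mathfrak{M}$ is ultrahomogeneous if every finite partial isomorphism from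 $\mathfrak{M}$ to itself extends to an automorphism of $\mathfrak{M}$. **Properties of $\mathcal{K}$.** A $\mathcal{K}$-structure is an $\mathcal{L}$-structure all of whose finite substructures are in $\mathcal{K}$. - HP: all members of $\mathcal{K}$ are $\mathcal{K}$-structures. - JEP: every two structures in $\mathcal{K}$ embed into a third one in $\mathcal{K}$. - AP: for all $\mathfrak{A},\mathfrak{B},\mathfrak{C}\in\mathcal{K}$ and embeddings $f_B\colon\mathfrak{A}\to\mathfrak{B}$, $f_C\colon\mathfrak{A}\to\mathfrak{C}$ there are $\mathfrak{D}\in\mathcal{K}$ and embeddings $g_B\colon\mathfrak{B}\to\mathfrak{D}$, $g_C\colon\mathfrak{C}\to\mathfrak{D}$ with $g_B\circ f_B=g_C\circ f_C$ on $A$. **Enumerated structures.** $\mathcal{K}_n$ is the set of enumerated structures of length $n$: all $n$-tuples $\bar a$ (repetitions allowed) of elements of some structure in $\mathcal{K}$, where the predicates can be evaluated on tuples of entries of $\bar a$. An embedding of $\bar a$ into a structure is a map from the entries of $\bar a$ to the structure preserving the values of all predicates. For $\bar a,\bar b\in\mathcal{K}_n$, $$d_{\mathcal{K}}(\bar a,\bar b)=\inf_{\bar a',\bar b'}\max_i d(a_i',b_i'),$$ where $\bar a',\bar b'$ range over the images of $\bar a,\bar b$ under embeddings into a common structure in $\mathcal{K}$; and $$d_\infty(\bar a,\bar b)=\max_{m\le n}\ \max_{X\subseteq\{1,\dots,n\},\,|X|=m,\ R\text{ of arity }m}|R(\bar a_X)-R(\bar b_X)|,$$ where $R$ ranges over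 the predicates including $d$, and $\bar a_X$ is the subtuple indexed by $X$. - PP: for every $n$, $\mathcal{K}_n$ is separable and complete under the pseudometric $d_{\mathcal{K}}$. - CP: for every $n$-ary predicate symbol $P$, the map $\mathcal{K}_n\to\mathbb{R}$, $\bar a\mapsto P(\bar a)$, is continuous with respect to $d_{\mathcal{K}}$. - bAP: for each $n$ there is a constant $c$ depending only on $n$ such that if $(\bar a,w)$ and $(\bar a,z)$ are two enumerated structures in $\mathcal{K}_n$ with common substructure $\bar a$, then there is an amalgamation $B=(\bar a,w,z)$ in $\mathcal{K}_{n+1}$ (its subtuples $(\bar a,w)$ and $(\bar a,z)$ carry the given predicate values) with $d_B(w,z)\le c\,d_\infty((\bar a,w),(\bar a,z))$. **Fraïssé classes and limits.** $\mathcal{K}$ is a Fraïssé class if it satisfies HP, JEP, AP, PP and CP. The limit (approximate limit) of a Fraïssé class is a separable $\mathcal{K}$-structure $\mathfrak{M}$ with the approximate extension property: for every finite $\mathcal{K}$-structure $\mathfrak{B}$, finite (possibly empty) tuple $\bar a$ of elements of $B$, embedding $h\colon\bar a\to\mathfrak{M}$ and $\epsilon>0$, there is an embedding $f\colon\mathfrak{B}\to\mathfrak{M}$ with $\max_i d(f(a_i),h(a_i))<\epsilon$. (Such a limit exists and is unique up to isomorphism.) An exact limit is a separable $\mathcal{K}$-structure with the exact extension property: for every such $\mathfrak{B}$, $\bar a$, $h$ there is an embedding $f\colon\mathfrak{B}\to\mathfrak{M}$ extending $h$.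
   Formalization: The claims are made for every limit of the class, whose existence is not asserted: with uniformly continuous predicates required but only continuity in CP, a limit can fail to exist (e.g. P = g + g³ with g 1-Lipschitz; also the empty class). *)

theory Defs
  imports "HOL-Analysis.Analysis"
begin

section \<open>Languages and structures\<close>

text \<open>The predicate symbols of a language are the elements of the type \<open>'r\<close>;
  \<open>dsym\<close> is the distinguished symbol interpreted by the metric.\<close>

record 'r language =
  arity :: "'r \<Rightarrow> nat"
  dsym :: 'r

definition is_language :: "'r language \<Rightarrow> bool" where
  "is_language L \<longleftrightarrow> arity L (dsym L) = 2 \<and> (\<forall>n. finite {R. arity L R = n})"

record ('a, 'r) lstruct =
  carrier :: "'a set"
  interp :: "'r \<Rightarrow> 'a list \<Rightarrow> real"

text \<open>Tuples are lists; only the values of \<open>interp\<close> on tuples of the right length over the carrier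
  are meaningful. The distance is set to 0 outside the carrier because the locale
  \<^locale>\<open>Metric_space\<close> requires nonnegativity and symmetry on the whole type.\<close>

definition tuples :: "nat \<Rightarrow> 'a set \<Rightarrow> 'a list set" where
  "tuples n S = {xs. length xs = n \<and> set xs \<subseteq> S}"

definition sdist :: "'r language \<Rightarrow> ('a, 'r) lstruct \<Rightarrow> 'a \<Rightarrow> 'a \<Rightarrow> real" where
  "sdist L A x y = (if x \<in> carrier A \<and> y \<in> carrier A then interp A (dsym L) [x, y] else 0)"

definition is_structure :: "'r language \<Rightarrow> ('a, 'r) lstruct \<Rightarrow> bool" where
  "is_structure L A \<longleftrightarrow>
     Metric_space (carrier A) (sdist L A) \<and>
     Metric_space.mcomplete (carrier A) (sdist L A) \<and>
     (\<forall>R. \<forall>e>0. \<exists>\<delta>>0. \<forall>xs \<in> tuples (arity L R) (carrier A). \<forall>ys \<in> tuples (arity L R) (carrier A).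
        (\<forall>i<arity L R. sdist L A (xs ! i) (ys ! i) < \<delta>) \<longrightarrow> \<bar>interp A R xs - interp A R ys\<bar> < e)"

definition is_separable :: "'r language \<Rightarrow> ('a, 'r) lstruct \<Rightarrow> bool" where
  "is_separable L A \<longleftrightarrow> separable_space (Metric_space.mtopology (carrier A) (sdist L A))"

definition is_embedding ::
  "'r language \<Rightarrow> ('a, 'r) lstruct \<Rightarrow> ('b, 'r) lstruct \<Rightarrow> ('a \<Rightarrow> 'b) \<Rightarrow> bool" where
  "is_embedding L A B f \<longleftrightarrow>
     f ` carrier A \<subseteq> carrier B \<and>
     (\<forall>R. \<forall>xs \<in> tuples (arity L R) (carrier A). interp B R (map f xs) = interp A R xs)"

definition is_isomorphism ::
  "'r language \<Rightarrow> ('a, 'r) lstruct \<Rightarrow> ('b, 'r) lstruct \<Rightarrow> ('a \<Rightarrow> 'b) \<Rightarrow> bool" where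
  "is_isomorphism L A B f \<longleftrightarrow> is_embedding L A B f \<and> f ` carrier A = carrier B"

abbreviation is_automorphism :: "'r language \<Rightarrow> ('a, 'r) lstruct \<Rightarrow> ('a \<Rightarrow> 'a) \<Rightarrow> bool" where
  "is_automorphism L A f \<equiv> is_isomorphism L A A f"

definition induced :: "('a, 'r) lstruct \<Rightarrow> 'a set \<Rightarrow> ('a, 'r) lstruct" where
  "induced A S = A\<lparr>carrier := S\<rparr>"

definition ultrahomogeneous :: "'r language \<Rightarrow> ('a, 'r) lstruct \<Rightarrow> bool" where
  "ultrahomogeneous L M \<longleftrightarrow>
     (\<forall>S f. finite S \<and> S \<subseteq> carrier M \<and> is_embedding L (induced M S) M f \<longrightarrow>
        (\<exists>g. is_automorphism L M g \<and> (\<forall>x\<in>S. g x = f x)))"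


section \<open>Classes of finite structures\<close>

text \<open>A class of finite structures is represented by its members whose carrier is a set of natural
  numbers. Substructures are meant up to isomorphism, so no finite structure is lost.\<close>

type_synonym 'r fclass = "(nat, 'r) lstruct set"

definition class_of_finite_structures :: "'r language \<Rightarrow> 'r fclass \<Rightarrow> bool" where
  "class_of_finite_structures L K \<longleftrightarrow> (\<forall>A\<in>K. is_structure L A \<and> finite (carrier A))"

definition K_structure :: "'r language \<Rightarrow> 'r fclass \<Rightarrow> ('a, 'r) lstruct \<Rightarrow> bool" where
  "K_structure L K M \<longleftrightarrow>
     is_structure L M \<and>
     (\<forall>A :: (nat, 'r) lstruct. is_structure L A \<and> finite (carrier A) \<and> (\<exists>f. is_embedding L A M f)
        \<longrightarrow> A \<in> K)"

definition HP :: "'r language \<Rightarrow> 'r fclass \<Rightarrow> bool" where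
  "HP L K \<longleftrightarrow> (\<forall>A\<in>K. K_structure L K A)"

definition JEP :: "'r language \<Rightarrow> 'r fclass \<Rightarrow> bool" where
  "JEP L K \<longleftrightarrow>
     (\<forall>A\<in>K. \<forall>B\<in>K. \<exists>C\<in>K. (\<exists>f. is_embedding L A C f) \<and> (\<exists>g. is_embedding L B C g))"

definition AP :: "'r language \<Rightarrow> 'r fclass \<Rightarrow> bool" where
  "AP L K \<longleftrightarrow>
     (\<forall>A\<in>K. \<forall>B\<in>K. \<forall>C\<in>K. \<forall>fB fC. is_embedding L A B fB \<and> is_embedding L A C fC \<longrightarrow>
        (\<exists>D\<in>K. \<exists>gB gC. is_embedding L B D gB \<and> is_embedding L C D gC \<and>
           (\<forall>x\<in>carrier A. gB (fB x) = gC (fC x))))"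


section \<open>Enumerated structures\<close>

text \<open>An enumerated structure is a tuple together with a structure of the class in which its
  predicates are evaluated. Entries are indexed from 0.\<close>

type_synonym 'r enum = "(nat, 'r) lstruct \<times> nat list"

definition Kn :: "'r fclass \<Rightarrow> nat \<Rightarrow> 'r enum set" where
  "Kn K n = {(A, xs). A \<in> K \<and> xs \<in> tuples n (carrier A)}"

definition enum_embedding :: "'r language \<Rightarrow> 'r enum \<Rightarrow> ('b, 'r) lstruct \<Rightarrow> (nat \<Rightarrow> 'b) \<Rightarrow> bool" where
  "enum_embedding L a B f \<longleftrightarrow> is_embedding L (induced (fst a) (set (snd a))) B f"

text \<open>Two enumerated structures are the same if all predicates agree on all tuples of
  corresponding entries.\<close>

definition same_enum :: "'r language \<Rightarrow> 'r enum \<Rightarrow> 'r enum \<Rightarrow> bool" where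
  "same_enum L a b \<longleftrightarrow>
     length (snd a) = length (snd b) \<and>
     (\<forall>R. \<forall>js \<in> tuples (arity L R) {..<length (snd a)}.
        interp (fst a) R (map ((!) (snd a)) js) = interp (fst b) R (map ((!) (snd b)) js))"

text \<open>In both maxima below the added 0 only supplies the value of a maximum over no indices,
  respectively over no predicates.\<close>

definition tuple_dist :: "'r language \<Rightarrow> ('a, 'r) lstruct \<Rightarrow> 'a list \<Rightarrow> 'a list \<Rightarrow> real" where
  "tuple_dist L D xs ys = Max (insert 0 {sdist L D (xs ! i) (ys ! i) |i. i < length xs})"

definition dK :: "'r language \<Rightarrow> 'r fclass \<Rightarrow> 'r enum \<Rightarrow> 'r enum \<Rightarrow> real" where
  "dK L K a b = Inf {tuple_dist L D (map f (snd a)) (map g (snd b)) |D f g.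
     D \<in> K \<and> enum_embedding L a D f \<and> enum_embedding L b D g}"

text \<open>The subtuple \<open>nths xs X\<close> lists the entries with index in \<open>X\<close> in increasing order of the
  index.\<close>

definition dinf :: "'r language \<Rightarrow> 'r enum \<Rightarrow> 'r enum \<Rightarrow> real" where
  "dinf L a b = Max (insert 0
     {\<bar>interp (fst a) R (nths (snd a) X) - interp (fst b) R (nths (snd b) X)\<bar> |R X.
        X \<subseteq> {..<length (snd a)} \<and> card X = arity L R})"

text \<open>\<open>d\<^sub>K\<close> is only a pseudometric, hence separability and completeness are spelled out.\<close>

definition PP :: "'r language \<Rightarrow> 'r fclass \<Rightarrow> bool" where
  "PP L K \<longleftrightarrow>
     (\<forall>n. (\<exists>S \<subseteq> Kn K n. countable S \<and> (\<forall>a\<in>Kn K n. \<forall>e>0. \<exists>s\<in>S. dK L K a s < e)) \<and>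
          (\<forall>\<sigma> :: nat \<Rightarrow> 'r enum. (\<forall>i. \<sigma> i \<in> Kn K n) \<and>
             (\<forall>e>0. \<exists>N. \<forall>i\<ge>N. \<forall>j\<ge>N. dK L K (\<sigma> i) (\<sigma> j) < e) \<longrightarrow>
             (\<exists>a\<in>Kn K n. (\<lambda>i. dK L K (\<sigma> i) a) \<longlonglongrightarrow> 0)))"

definition CP :: "'r language \<Rightarrow> 'r fclass \<Rightarrow> bool" where
  "CP L K \<longleftrightarrow>
     (\<forall>P. \<forall>a \<in> Kn K (arity L P). \<forall>e>0. \<exists>\<delta>>0. \<forall>b \<in> Kn K (arity L P).
        dK L K a b < \<delta> \<longrightarrow> \<bar>interp (fst a) P (snd a) - interp (fst b) P (snd b)\<bar> < e)"

definition bAP :: "'r language \<Rightarrow> 'r fclass \<Rightarrow> bool" where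
  "bAP L K \<longleftrightarrow>
     (\<forall>n. \<exists>c. \<forall>A xs w B ys z.
        (A, xs @ [w]) \<in> Kn K n \<and> (B, ys @ [z]) \<in> Kn K n \<and> same_enum L (A, xs) (B, ys) \<longrightarrow>
        (\<exists>D us w' z'. (D, us @ [w', z']) \<in> Kn K (n + 1) \<and>
           same_enum L (D, us @ [w']) (A, xs @ [w]) \<and>
           same_enum L (D, us @ [z']) (B, ys @ [z]) \<and>
           sdist L D w' z' \<le> c * dinf L (A, xs @ [w]) (B, ys @ [z])))"


section \<open>Fraisse classes and limits\<close>

definition Fraisse_class :: "'r language \<Rightarrow> 'r fclass \<Rightarrow> bool" where
  "Fraisse_class L K \<longleftrightarrow> HP L K \<and> JEP L K \<and> AP L K \<and> PP L K \<and> CP L K"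

definition separable_K_structure :: "'r language \<Rightarrow> 'r fclass \<Rightarrow> ('a, 'r) lstruct \<Rightarrow> bool" where
  "separable_K_structure L K M \<longleftrightarrow> K_structure L K M \<and> is_separable L M"

definition approximate_limit :: "'r language \<Rightarrow> 'r fclass \<Rightarrow> ('a, 'r) lstruct \<Rightarrow> bool" where
  "approximate_limit L K M \<longleftrightarrow>
     separable_K_structure L K M \<and>
     (\<forall>(B :: (nat, 'r) lstruct) xs h e.
        K_structure L K B \<and> finite (carrier B) \<and> set xs \<subseteq> carrier B \<and>
        enum_embedding L (B, xs) M h \<and> e > 0 \<longrightarrow>
        (\<exists>f. is_embedding L B M f \<and> tuple_dist L M (map f xs) (map h xs) < e))"

definition exact_limit :: "'r language \<Rightarrow> 'r fclass \<Rightarrow> ('a, 'r) lstruct \<Rightarrow> bool" where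
  "exact_limit L K M \<longleftrightarrow>
     separable_K_structure L K M \<and>
     (\<forall>(B :: (nat, 'r) lstruct) xs h.
        K_structure L K B \<and> finite (carrier B) \<and> set xs \<subseteq> carrier B \<and>
        enum_embedding L (B, xs) M h \<longrightarrow>
        (\<exists>f. is_embedding L B M f \<and> (\<forall>x\<in>set xs. f x = h x)))"

text \<open>Universality for the separable structures carried by subsets of the type \<open>'u\<close>. Separable metric
  spaces have at most the cardinality of the continuum, so \<open>'u = real\<close> covers all of them up to
  isomorphism.\<close>

definition universal :: "'u itself \<Rightarrow> 'r language \<Rightarrow> 'r fclass \<Rightarrow> ('a, 'r) lstruct \<Rightarrow> bool" where
  "universal _ L K M \<longleftrightarrow>
     (\<forall>N :: ('u, 'r) lstruct. separable_K_structure L K N \<longrightarrow> (\<exists>f. is_embedding L N M f))"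

end

theory Submission
  imports Defs
begin

text \<open>
  All constructions are carried out with partial isomorphisms, that is, relations between two structures
  that preserve every predicate. The amalgamation property follows from \<open>bAP\<close> because amalgamating one
  point over a common part, repeatedly, amalgamates finite structures: first one point of the one structure
  is amalgamated with all points of the other (\<open>amalgamate_point_with_structure\<close>), then the remaining points
  follow one by one (\<open>amalgamate_structures\<close>).

  The main point is that an approximate limit \<open>M\<close> realizes one-point extensions exactly
  (\<open>approximate_limit_one_point_extension\<close>). Let \<open>xs @ [w]\<close> be a tuple of a member of the class and let \<open>hs\<close>
  be a tuple in \<open>M\<close> of the same type as \<open>xs\<close>. Approximate extension gives \<open>u\<close> in \<open>M\<close> that has the type of
  \<open>w\<close> over a tuple close to \<open>hs\<close>. As the finitely many relevant predicates are uniformly continuous, \<open>u\<close>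
  and \<open>w\<close> have \<open>dinf\<close>-close types over \<open>hs\<close>, and \<open>bAP\<close> yields a common amalgam in which they are close to
  each other. A second approximate extension maps the amalgam to \<open>M\<close>; its image of \<open>w\<close> improves on \<open>u\<close> and
  lies close to \<open>u\<close> (\<open>improve_approximation\<close>). The improvements form a Cauchy sequence, and the limit is an
  exact realization because the predicates are continuous.

  Exact one-point extension makes the classical arguments available. Going forth through a countable dense
  set and passing to the completion embeds every separable structure over the class into \<open>M\<close>, extending any
  finite partial isomorphism: this gives universality and the exact limit. Going back and forth between two
  separable structures with one-point extension produces isomorphisms
  (\<open>extension_to_isomorphism\<close>), which gives ultrahomogeneity. Finally, a universal ultrahomogeneous structure
  also has the one-point extension property, since an automorphism moves an arbitrary copy of a finite
  structure into the prescribed position; so it is isomorphic to \<open>M\<close>.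
\<close>

section \<open>Partial isomorphisms\<close>

text \<open>Partial isomorphisms are relations rather than functions on subsets, because relations can be
  inverted, composed and united without tracking domains or choosing representatives. Since the
  metric is one of the predicates, such a relation between structures is automatically the graph of
  an injection.\<close>

definition partial_iso ::
  "'r language \<Rightarrow> ('a, 'r) lstruct \<Rightarrow> ('b, 'r) lstruct \<Rightarrow> ('a \<times> 'b) set \<Rightarrow> bool" where
  "partial_iso L A B P \<longleftrightarrow> P \<subseteq> carrier A \<times> carrier B \<and>
     (\<forall>R. \<forall>ps \<in> tuples (arity L R) P. interp A R (map fst ps) = interp B R (map snd ps))"

lemma partial_iso_carrier: "partial_iso L A B P \<Longrightarrow> (x, y) \<in> P \<Longrightarrow> x \<in> carrier A \<and> y \<in> carrier B"
  by (auto simp: partial_iso_def)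

lemma partial_iso_subset: "partial_iso L A B P \<Longrightarrow> Q \<subseteq> P \<Longrightarrow> partial_iso L A B Q"
  unfolding partial_iso_def tuples_def by (auto 0 4)

lemma partial_iso_converse:
  assumes "partial_iso L A B P"
  shows "partial_iso L B A (P\<inverse>)"
  unfolding partial_iso_def
proof (intro conjI allI ballI)
  show "P\<inverse> \<subseteq> carrier B \<times> carrier A"
    using partial_iso_carrier[OF assms] by blast
next
  fix R ps assume "ps \<in> tuples (arity L R) (P\<inverse>)"
  then have "map prod.swap ps \<in> tuples (arity L R) P"
    by (auto simp: tuples_def)
  then have "interp A R (map fst (map prod.swap ps)) = interp B R (map snd (map prod.swap ps))"
    using assms by (simp only: partial_iso_def)
  then show "interp B R (map fst ps) = interp A R (map snd ps)"
    by (simp add: comp_def)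
qed

lemma partial_iso_comp:
  assumes AB: "partial_iso L A B P" and BC: "partial_iso L B C Q"
  shows "partial_iso L A C (P O Q)"
  unfolding partial_iso_def
proof (intro conjI allI ballI)
  show "P O Q \<subseteq> carrier A \<times> carrier C"
    using partial_iso_carrier[OF AB] partial_iso_carrier[OF BC] by blast
next
  fix R ps assume ps: "ps \<in> tuples (arity L R) (P O Q)"
  have "\<forall>p \<in> P O Q. \<exists>y. (fst p, y) \<in> P \<and> (y, snd p) \<in> Q"
    by auto
  then obtain m where m: "\<And>p. p \<in> P O Q \<Longrightarrow> (fst p, m p) \<in> P \<and> (m p, snd p) \<in> Q"
    by metis
  have "map (\<lambda>p. (fst p, m p)) ps \<in> tuples (arity L R) P"
    "map (\<lambda>p. (m p, snd p)) ps \<in> tuples (arity L R) Q"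
    using ps m by (auto simp: tuples_def subset_iff)
  then have "interp A R (map fst (map (\<lambda>p. (fst p, m p)) ps)) =
      interp B R (map snd (map (\<lambda>p. (fst p, m p)) ps))"
    and "interp B R (map fst (map (\<lambda>p. (m p, snd p)) ps)) =
      interp C R (map snd (map (\<lambda>p. (m p, snd p)) ps))"
    using AB BC unfolding partial_iso_def by blast+
  then show "interp A R (map fst ps) = interp C R (map snd ps)"
    by (simp add: comp_def)
qed

lemma partial_iso_Id_on:
  fixes A :: "('a, 'r) lstruct"
  shows "partial_iso L A A (Id_on (carrier A))"
  unfolding partial_iso_def
proof (intro conjI allI ballI)
  fix R ps assume "ps \<in> tuples (arity L R) (Id_on (carrier A))"
  then have "map fst ps = map snd ps"
    by (auto simp: tuples_def)
  then show "interp A R (map fst ps) = interp A R (map snd ps)"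
    by (rule arg_cong)
qed auto

lemma partial_iso_graph:
  assumes "is_embedding L (induced A S) B f" "S \<subseteq> carrier A"
  shows "partial_iso L A B ((\<lambda>x. (x, f x)) ` S)"
  unfolding partial_iso_def
proof (intro conjI allI ballI)
  show "(\<lambda>x. (x, f x)) ` S \<subseteq> carrier A \<times> carrier B"
    using assms by (auto simp: is_embedding_def induced_def)
next
  fix R ps assume ps: "ps \<in> tuples (arity L R) ((\<lambda>x. (x, f x)) ` S)"
  then have snd: "map snd ps = map f (map fst ps)"
    by (auto simp: tuples_def)
  have "map fst ps \<in> tuples (arity L R) S"
    using ps by (auto simp: tuples_def)
  then show "interp A R (map fst ps) = interp B R (map snd ps)"
    using assms(1) unfolding snd by (simp add: is_embedding_def induced_def del: map_map)
qed

lemma induced_carrier [simp]: "induced A (carrier A) = A"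
  by (simp add: induced_def)

lemma embedding_graph:
  "is_embedding L A B f \<Longrightarrow> partial_iso L A B ((\<lambda>x. (x, f x)) ` carrier A)"
  using partial_iso_graph[of L A "carrier A" B f] by simp

lemma embedding_partial_iso:
  assumes "is_embedding L A B f" "P \<subseteq> {(x, f x) |x. x \<in> carrier A}"
  shows "partial_iso L A B P"
  using embedding_graph[OF assms(1)] by (rule partial_iso_subset) (use assms(2) in auto)

lemma partial_iso_dist:
  assumes L: "is_language L" and P: "partial_iso L A B P" and "(x, y) \<in> P" "(x', y') \<in> P"
  shows "sdist L A x x' = sdist L B y y'"
proof -
  have "[(x, y), (x', y')] \<in> tuples (arity L (dsym L)) P"
    using L assms by (simp add: tuples_def is_language_def)
  then have "interp A (dsym L) (map fst [(x, y), (x', y')]) =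
      interp B (dsym L) (map snd [(x, y), (x', y')])"
    using P unfolding partial_iso_def by blast
  then show ?thesis
    using partial_iso_carrier[OF P] assms(3,4) by (simp add: sdist_def)
qed

lemma structure_metric: "is_structure L A \<Longrightarrow> Metric_space (carrier A) (sdist L A)"
  by (simp add: is_structure_def)

text \<open>Two partners of \<open>x\<close> have the same distance as \<open>x\<close> from itself. Applied to the converse relation this
  gives injectivity.\<close>

lemma partial_iso_functional:
  assumes L: "is_language L" and B: "is_structure L B" and P: "partial_iso L A B P"
    and xy: "(x, y) \<in> P" "(x, y') \<in> P" and A: "is_structure L A"
  shows "y = y'"
proof -
  interpret A: Metric_space "carrier A" "sdist L A"
    using A by (rule structure_metric)
  interpret B: Metric_space "carrier B" "sdist L B"
    using B by (rule structure_metric)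
  have "sdist L B y y' = 0"
    using partial_iso_dist[OF L P xy] partial_iso_carrier[OF P] xy by fastforce
  then show ?thesis
    using partial_iso_carrier[OF P] xy by (metis B.zero)
qed

lemma partial_iso_function:
  assumes L: "is_language L" and A: "is_structure L A" and B: "is_structure L B"
    and P: "partial_iso L A B P"
  shows "\<exists>f. (\<forall>(x, y) \<in> P. f x = y) \<and> is_embedding L (induced A (Domain P)) B f"
proof -
  define f where "f x = (THE y. (x, y) \<in> P)" for x
  have f: "f x = y" if "(x, y) \<in> P" for x y
    unfolding f_def using that partial_iso_functional[OF L B P _ _ A] by blast
  have "interp B R (map f xs) = interp A R xs" if "xs \<in> tuples (arity L R) (Domain P)" for R xs
  proof -
    have "map (\<lambda>x. (x, f x)) xs \<in> tuples (arity L R) P"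
      using that f by (fastforce simp: tuples_def)
    then have "interp A R (map fst (map (\<lambda>x. (x, f x)) xs)) =
        interp B R (map snd (map (\<lambda>x. (x, f x)) xs))"
      using P unfolding partial_iso_def by blast
    then show ?thesis
      by (simp add: comp_def)
  qed
  moreover have "f ` Domain P \<subseteq> carrier B"
    using f partial_iso_carrier[OF P] by auto
  ultimately have "is_embedding L (induced A (Domain P)) B f"
    by (simp add: is_embedding_def induced_def)
  with f show ?thesis by blast
qed

lemma partial_iso_total:
  assumes "is_language L" "is_structure L A" "is_structure L B"
    and "partial_iso L A B P" "Domain P = carrier A"
  shows "\<exists>f. (\<forall>(x, y) \<in> P. f x = y) \<and> is_embedding L A B f"
  using partial_iso_function[OF assms(1-4)] assms(5) by simp

section \<open>Limits and completions of partial isomorphisms\<close>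

text \<open>Uniform continuity phrased with one list of pairs instead of two lists, so that it can be applied to
  lists picked pair by pair.\<close>

lemma structure_uniformly_continuous:
  assumes A: "is_structure L A" and "e > 0"
  obtains \<delta> where "\<delta> > 0"
    "\<And>qs. qs \<in> tuples (arity L R) (carrier A \<times> carrier A) \<Longrightarrow>
       (\<And>x y. (x, y) \<in> set qs \<Longrightarrow> sdist L A x y < \<delta>) \<Longrightarrow>
       \<bar>interp A R (map fst qs) - interp A R (map snd qs)\<bar> < e"
proof -
  obtain \<delta> where \<delta>: "\<delta> > 0"
    "\<And>xs ys. xs \<in> tuples (arity L R) (carrier A) \<Longrightarrow> ys \<in> tuples (arity L R) (carrier A) \<Longrightarrow>
       (\<And>i. i < arity L R \<Longrightarrow> sdist L A (xs ! i) (ys ! i) < \<delta>) \<Longrightarrow>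
       \<bar>interp A R xs - interp A R ys\<bar> < e"
    using assms unfolding is_structure_def by meson
  show ?thesis
  proof (rule that[OF \<delta>(1)])
    fix qs assume qs: "qs \<in> tuples (arity L R) (carrier A \<times> carrier A)"
      and small: "\<And>x y. (x, y) \<in> set qs \<Longrightarrow> sdist L A x y < \<delta>"
    show "\<bar>interp A R (map fst qs) - interp A R (map snd qs)\<bar> < e"
    proof (rule \<delta>(2))
      fix i assume "i < arity L R"
      then have i: "i < length qs"
        using qs by (simp add: tuples_def)
      then show "sdist L A (map fst qs ! i) (map snd qs ! i) < \<delta>"
        using small[of "fst (qs ! i)" "snd (qs ! i)"] by simp
    qed (use qs in \<open>auto simp: tuples_def\<close>)
  qed
qed

text \<open>Both predicates are uniformly continuous, so equality of their values passes to limits. The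
  approximating partial isomorphism may depend on \<open>e\<close>: this covers at once the closure of one partial
  isomorphism and the limit of a sequence of them.\<close>

lemma partial_iso_approx:
  assumes A: "is_structure L A" and B: "is_structure L B"
    and Q: "Q \<subseteq> carrier A \<times> carrier B"
    and approx: "\<And>e. e > 0 \<Longrightarrow> \<exists>P. partial_iso L A B P \<and>
       (\<forall>(x, y) \<in> Q. \<exists>(a, b) \<in> P. sdist L A x a < e \<and> sdist L B y b < e)"
  shows "partial_iso L A B Q"
  unfolding partial_iso_def
proof (intro conjI allI ballI)
  fix R qs assume qs: "qs \<in> tuples (arity L R) Q"
  have "\<bar>interp A R (map fst qs) - interp B R (map snd qs)\<bar> \<le> 0 + e" if "e > 0" for e
  proof -
    have "e / 2 > 0" using that by simp
    obtain \<delta> where \<delta>: "\<delta> > 0"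
      "\<And>qs. qs \<in> tuples (arity L R) (carrier A \<times> carrier A) \<Longrightarrow>
         (\<And>x y. (x, y) \<in> set qs \<Longrightarrow> sdist L A x y < \<delta>) \<Longrightarrow>
         \<bar>interp A R (map fst qs) - interp A R (map snd qs)\<bar> < e / 2"
      using structure_uniformly_continuous[OF A \<open>e / 2 > 0\<close>, of R] by metis
    obtain \<eta> where \<eta>: "\<eta> > 0"
      "\<And>qs. qs \<in> tuples (arity L R) (carrier B \<times> carrier B) \<Longrightarrow>
         (\<And>x y. (x, y) \<in> set qs \<Longrightarrow> sdist L B x y < \<eta>) \<Longrightarrow>
         \<bar>interp B R (map fst qs) - interp B R (map snd qs)\<bar> < e / 2"
      using structure_uniformly_continuous[OF B \<open>e / 2 > 0\<close>, of R] by metis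
    obtain P where P: "partial_iso L A B P"
      and near: "\<forall>(x, y) \<in> Q. \<exists>(a, b) \<in> P. sdist L A x a < min \<delta> \<eta> \<and> sdist L B y b < min \<delta> \<eta>"
      using approx[of "min \<delta> \<eta>"] \<delta>(1) \<eta>(1) by auto
    have "\<forall>q\<in>Q. \<exists>p. p \<in> P \<and> sdist L A (fst q) (fst p) < min \<delta> \<eta> \<and>
        sdist L B (snd q) (snd p) < min \<delta> \<eta>"
      using near by fastforce
    then obtain \<phi> where \<phi>: "\<And>q. q \<in> Q \<Longrightarrow> \<phi> q \<in> P" and
        \<phi>': "\<And>q. q \<in> Q \<Longrightarrow> sdist L A (fst q) (fst (\<phi> q)) < min \<delta> \<eta>"
        "\<And>q. q \<in> Q \<Longrightarrow> sdist L B (snd q) (snd (\<phi> q)) < min \<delta> \<eta>"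
      by metis
    have qsQ: "set qs \<subseteq> Q" "length qs = arity L R"
      using qs by (auto simp: tuples_def)
    have \<phi>c: "fst (\<phi> q) \<in> carrier A \<and> snd (\<phi> q) \<in> carrier B" if "q \<in> Q" for q
      using \<phi>[OF that] partial_iso_carrier[OF P, of "fst (\<phi> q)" "snd (\<phi> q)"] by simp
    let ?a = "map (\<lambda>q. (fst q, fst (\<phi> q))) qs" and ?b = "map (\<lambda>q. (snd q, snd (\<phi> q))) qs"
    have "\<bar>interp A R (map fst ?a) - interp A R (map snd ?a)\<bar> < e / 2"
    proof (rule \<delta>(2))
      show "?a \<in> tuples (arity L R) (carrier A \<times> carrier A)"
        using qsQ Q \<phi>c by (fastforce simp: tuples_def)
    qed (use qsQ \<phi>' in fastforce)
    moreover have "\<bar>interp B R (map fst ?b) - interp B R (map snd ?b)\<bar> < e / 2"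
    proof (rule \<eta>(2))
      show "?b \<in> tuples (arity L R) (carrier B \<times> carrier B)"
        using qsQ Q \<phi>c by (fastforce simp: tuples_def)
    qed (use qsQ \<phi>' in fastforce)
    moreover have "interp A R (map fst (map \<phi> qs)) = interp B R (map snd (map \<phi> qs))"
    proof -
      have "map \<phi> qs \<in> tuples (arity L R) P"
        using qsQ \<phi> by (auto simp: tuples_def)
      then show ?thesis
        using P unfolding partial_iso_def by blast
    qed
    ultimately show ?thesis
      by (simp only: map_map comp_def fst_conv snd_conv)
  qed
  then have "\<bar>interp A R (map fst qs) - interp B R (map snd qs)\<bar> \<le> 0"
    by (rule field_le_epsilon)
  then show "interp A R (map fst qs) = interp B R (map snd qs)"
    by simp
qed (rule Q)

definition dense_in :: "'r language \<Rightarrow> ('a, 'r) lstruct \<Rightarrow> 'a set \<Rightarrow> bool" where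
  "dense_in L A C \<longleftrightarrow> C \<subseteq> carrier A \<and> (\<forall>x\<in>carrier A. \<forall>e>0. \<exists>c\<in>C. sdist L A x c < e)"

lemma separable_dense:
  assumes A: "is_structure L A" and "is_separable L A"
  obtains C where "countable C" "dense_in L A C"
proof -
  interpret Metric_space "carrier A" "sdist L A"
    using A by (rule structure_metric)
  obtain C where C: "countable C" "C \<subseteq> carrier A" "mtopology closure_of C = carrier A"
    using assms(2) unfolding is_separable_def separable_space_def by auto
  have "\<exists>c\<in>C. sdist L A x c < e" if "x \<in> carrier A" "e > 0" for x e
  proof -
    have "x \<in> mtopology closure_of C" using that C by simp
    then show ?thesis
      using that unfolding metric_closure_of by (auto simp: mball_def)
  qed
  then show ?thesis
    using C that[of C] by (auto simp: dense_in_def)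
qed

text \<open>A sequence in the domain that converges to \<open>x\<close> is Cauchy, its partners have the same mutual distances,
  and completeness of \<open>B\<close> supplies the limit.\<close>

lemma partial_iso_completion_total:
  assumes L: "is_language L" and A: "is_structure L A" and B: "is_structure L B"
    and P: "partial_iso L A B P" and dense: "dense_in L A (Domain P)" and x: "x \<in> carrier A"
  shows "\<exists>y\<in>carrier B. \<forall>e>0. \<exists>(a, b) \<in> P. sdist L A x a < e \<and> sdist L B y b < e"
proof -
  interpret A: Metric_space "carrier A" "sdist L A"
    using A by (rule structure_metric)
  interpret B: Metric_space "carrier B" "sdist L B"
    using B by (rule structure_metric)
  have "\<exists>a b. (a, b) \<in> P \<and> sdist L A x a < inverse (real (Suc k))" for k
    using dense x unfolding dense_in_def by (metis DomainE inverse_positive_iff_positive of_nat_0_less_iff zero_less_Suc)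
  then obtain a b where ab: "\<And>k. (a k, b k) \<in> P"
    and near: "\<And>k. sdist L A x (a k) < inverse (real (Suc k))"
    by metis
  have car: "a k \<in> carrier A" "b k \<in> carrier B" for k
    using partial_iso_carrier[OF P ab] by auto
  have small: "\<exists>N. \<forall>k\<ge>N. sdist L A x (a k) < e" if e: "e > 0" for e
  proof -
    obtain N where N: "inverse (real (Suc N)) < e"
      using reals_Archimedean[OF e] by blast
    have "sdist L A x (a k) < e" if "k \<ge> N" for k
    proof -
      have "inverse (real (Suc k)) \<le> inverse (real (Suc N))"
        using that by simp
      then show ?thesis using near[of k] N by linarith
    qed
    then show ?thesis by blast
  qed
  have "B.MCauchy b"
    unfolding B.MCauchy_def
  proof (intro conjI allI impI)
    show "range b \<subseteq> carrier B" using car by auto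
    fix e :: real assume "e > 0"
    then obtain N where N: "\<And>k. k \<ge> N \<Longrightarrow> sdist L A x (a k) < e / 2"
      using small[of "e / 2"] by auto
    have "sdist L B (b n) (b n') < e" if "N \<le> n" "N \<le> n'" for n n'
    proof -
      have "sdist L B (b n) (b n') = sdist L A (a n) (a n')"
        using partial_iso_dist[OF L P ab ab] by simp
      also have "\<dots> \<le> sdist L A x (a n) + sdist L A x (a n')"
        using A.triangle[of "a n" x "a n'"] car x A.commute[of x "a n"] by simp
      also have "\<dots> < e" using N[OF that(1)] N[OF that(2)] by simp
      finally show ?thesis .
    qed
    then show "\<exists>N. \<forall>n n'. N \<le> n \<longrightarrow> N \<le> n' \<longrightarrow> sdist L B (b n) (b n') < e"
      by blast
  qed
  then obtain y where y: "limitin B.mtopology b y sequentially"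
    using B unfolding is_structure_def B.mcomplete_def by blast
  have yB: "y \<in> carrier B"
    using y B.limitin_mspace by blast
  moreover have "\<exists>(a, b) \<in> P. sdist L A x a < e \<and> sdist L B y b < e" if "e > 0" for e
  proof -
    obtain N where N: "\<And>k. k \<ge> N \<Longrightarrow> sdist L B (b k) y < e"
      using y \<open>e > 0\<close> unfolding B.limit_metric_sequentially by blast
    obtain N' where N': "\<And>k. k \<ge> N' \<Longrightarrow> sdist L A x (a k) < e"
      using small \<open>e > 0\<close> by blast
    show ?thesis
      using ab[of "max N N'"] N[of "max N N'"] N'[of "max N N'"] B.commute[of y] by auto
  qed
  ultimately show ?thesis by blast
qed

text \<open>The witness is the closure of \<open>P\<close> in the product. It is defined symmetrically in both structures, so
  the statement about the range is the one about the domain of the converse.\<close>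

lemma partial_iso_completion:
  assumes L: "is_language L" and A: "is_structure L A" and B: "is_structure L B"
    and P: "partial_iso L A B P"
  obtains Q where "P \<subseteq> Q" "partial_iso L A B Q"
    "dense_in L A (Domain P) \<Longrightarrow> Domain Q = carrier A"
    "dense_in L B (Range P) \<Longrightarrow> Range Q = carrier B"
proof
  interpret A: Metric_space "carrier A" "sdist L A"
    using A by (rule structure_metric)
  interpret B: Metric_space "carrier B" "sdist L B"
    using B by (rule structure_metric)
  define Q where "Q = {(x, y) \<in> carrier A \<times> carrier B.
    \<forall>e>0. \<exists>(a, b) \<in> P. sdist L A x a < e \<and> sdist L B y b < e}"
  show "P \<subseteq> Q"
  proof (rule subrelI)
    fix x y assume xy: "(x, y) \<in> P"
    then have "x \<in> carrier A" "y \<in> carrier B"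
      using partial_iso_carrier[OF P] by auto
    then show "(x, y) \<in> Q"
      using xy unfolding Q_def by (auto intro!: bexI[of _ "(x, y)"])
  qed
  show iso: "partial_iso L A B Q"
    by (rule partial_iso_approx[OF A B]) (use P in \<open>auto simp: Q_def\<close>)
  show "Domain Q = carrier A" if "dense_in L A (Domain P)"
    using partial_iso_completion_total[OF L A B P that] unfolding Q_def by blast
  show "Range Q = carrier B" if "dense_in L B (Range P)"
  proof -
    have "dense_in L B (Domain (P\<inverse>))" using that by simp
    note total = partial_iso_completion_total[OF L B A partial_iso_converse[OF P] this]
    have "y \<in> Range Q" if y: "y \<in> carrier B" for y
    proof -
      obtain x where "x \<in> carrier A"
        and "\<forall>e>0. \<exists>(b, a) \<in> P\<inverse>. sdist L B y b < e \<and> sdist L A x a < e"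
        using total[OF y] by blast
      then have "(x, y) \<in> Q" using y unfolding Q_def by fastforce
      then show ?thesis by blast
    qed
    then show ?thesis unfolding Q_def by blast
  qed
qed

section \<open>Back and forth\<close>

text \<open>Countably many tasks are performed one after the other; \<open>D t P\<close> means that \<open>P\<close> accomplishes task \<open>t\<close>.\<close>

lemma countable_task_chain:
  assumes "countable T" and P0: "Q P0"
    and step: "\<And>P t. Q P \<Longrightarrow> t \<in> T \<Longrightarrow> \<exists>P'. P \<subseteq> P' \<and> Q P' \<and> D t P'"
  obtains S :: "nat \<Rightarrow> 'x set" where "S 0 = P0" "incseq S" "\<And>n. Q (S n)" "\<And>t. t \<in> T \<Longrightarrow> \<exists>n. D t (S n)"
proof (cases "T = {}")
  case True
  then show ?thesis
    using that[of "\<lambda>_. P0"] P0 by (auto simp: incseq_def)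
next
  case False
  let ?t = "from_nat_into T"
  have "\<exists>S. \<forall>n. (Q (S n) \<and> (n = 0 \<longrightarrow> S n = P0)) \<and> (S n \<subseteq> S (Suc n) \<and> D (?t n) (S (Suc n)))"
  proof (rule dependent_nat_choice)
    show "\<exists>x. Q x \<and> (0 = (0::nat) \<longrightarrow> x = P0)" using P0 by blast
    show "\<exists>y. (Q y \<and> (Suc n = 0 \<longrightarrow> y = P0)) \<and> x \<subseteq> y \<and> D (?t n) y"
      if "Q x \<and> (n = 0 \<longrightarrow> x = P0)" for x n
      using step[of x "?t n"] that from_nat_into[OF False] by auto
  qed
  then obtain S where "\<And>n. Q (S n)" "S 0 = P0" and S: "\<And>n. S n \<subseteq> S (Suc n)"
      "\<And>n. D (?t n) (S (Suc n))"
    by blast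
  moreover have "\<exists>n. D t (S n)" if "t \<in> T" for t
    using S(2)[of "to_nat_on T t"] that \<open>countable T\<close> by auto
  ultimately show ?thesis
    using that[of S] by (simp add: incseq_SucI)
qed

lemma finite_subset_incseq_Union:
  assumes "finite F" "F \<subseteq> (\<Union>n. S n)" "incseq S"
  shows "\<exists>n. F \<subseteq> S (n::nat)"
  using assms(1,2)
proof (induction F)
  case (insert x F)
  then obtain n m where "F \<subseteq> S n" "x \<in> S m" by auto
  moreover have "S n \<subseteq> S (max n m)" "S m \<subseteq> S (max n m)"
    using \<open>incseq S\<close> by (simp_all add: incseq_def)
  ultimately show ?case by blast
qed simp

text \<open>A predicate only sees finitely many pairs, so the union of an increasing chain of partial isomorphisms
  is again one. With \<open>Y = {}\<close> this is the one-sided construction that gives embeddings.\<close>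

lemma back_and_forth:
  assumes "countable X" "countable Y" and P0: "finite P0" "partial_iso L A B P0"
    and left: "\<And>P x. finite P \<Longrightarrow> partial_iso L A B P \<Longrightarrow> x \<in> X \<Longrightarrow> \<exists>y. partial_iso L A B (insert (x, y) P)"
    and right: "\<And>P y. finite P \<Longrightarrow> partial_iso L A B P \<Longrightarrow> y \<in> Y \<Longrightarrow> \<exists>x. partial_iso L A B (insert (x, y) P)"
  obtains P where "P0 \<subseteq> P" "partial_iso L A B P" "X \<subseteq> Domain P" "Y \<subseteq> Range P"
proof -
  define D where "D t P = (case t of Inl x \<Rightarrow> x \<in> Domain P | Inr y \<Rightarrow> y \<in> Range P)"
    for t and P :: "('a \<times> 'b) set"
  have tasks: "countable (X <+> Y)" using assms by (simp add: Plus_def)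
  have start: "finite P0 \<and> partial_iso L A B P0" using P0 by simp
  have step: "\<exists>P'. P \<subseteq> P' \<and> (finite P' \<and> partial_iso L A B P') \<and> D t P'"
    if P: "finite P \<and> partial_iso L A B P" and t: "t \<in> X <+> Y" for P t
  proof (cases t)
    case (Inl x)
    then obtain y where "partial_iso L A B (insert (x, y) P)" using left[of P x] P t by auto
    then show ?thesis using P Inl by (intro exI[of _ "insert (x, y) P"]) (auto simp: D_def)
  next
    case (Inr y)
    then obtain x where "partial_iso L A B (insert (x, y) P)" using right[of P y] P t by auto
    then show ?thesis using P Inr by (intro exI[of _ "insert (x, y) P"]) (auto simp: D_def)
  qed
  obtain S where S: "S 0 = P0" "incseq S" "\<And>n. finite (S n) \<and> partial_iso L A B (S n)"
      "\<And>t. t \<in> X <+> Y \<Longrightarrow> \<exists>n. D t (S n)"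
    using countable_task_chain[of "X <+> Y" "\<lambda>P. finite P \<and> partial_iso L A B P" P0 D,
        OF tasks start step] by blast
  show ?thesis
  proof
    show "P0 \<subseteq> (\<Union>n. S n)" using S(1) by blast
    show "partial_iso L A B (\<Union>n. S n)"
      unfolding partial_iso_def
    proof (intro conjI allI ballI)
      show "(\<Union>n. S n) \<subseteq> carrier A \<times> carrier B"
        using S(3) unfolding partial_iso_def by blast
      fix R ps assume ps: "ps \<in> tuples (arity L R) (\<Union>n. S n)"
      then obtain n where "set ps \<subseteq> S n"
        using finite_subset_incseq_Union[OF _ _ S(2), of "set ps"] by (auto simp: tuples_def)
      then have "ps \<in> tuples (arity L R) (S n)" using ps by (simp add: tuples_def)
      then show "interp A R (map fst ps) = interp B R (map snd ps)"
        using S(3) unfolding partial_iso_def by blast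
    qed
    show "X \<subseteq> Domain (\<Union>n. S n)"
    proof
      fix x assume "x \<in> X"
      then show "x \<in> Domain (\<Union>n. S n)" using S(4)[of "Inl x"] by (auto simp: D_def)
    qed
    show "Y \<subseteq> Range (\<Union>n. S n)"
    proof
      fix y assume "y \<in> Y"
      then show "y \<in> Range (\<Union>n. S n)" using S(4)[of "Inr y"] by (auto simp: D_def)
    qed
  qed
qed

section \<open>Finite copies\<close>

text \<open>Completeness of the copy holds because a finite metric space is compact. The target type is arbitrary:
  natural numbers are used to enter the class, real numbers to apply universality.\<close>

lemma finite_copy:
  fixes N :: "('a, 'r) lstruct" and e :: "'a \<Rightarrow> 'b"
  assumes L: "is_language L" and N: "is_structure L N"
    and S: "finite S" "S \<subseteq> carrier N" "inj_on e S"
  obtains A :: "('b, 'r) lstruct" where "carrier A = e ` S" "is_structure L A"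
    "partial_iso L N A ((\<lambda>x. (x, e x)) ` S)"
proof
  let ?i = "inv_into S e"
  define A :: "('b, 'r) lstruct" where
    "A = \<lparr>carrier = e ` S, interp = \<lambda>R xs. interp N R (map ?i xs)\<rparr>"
  show A: "carrier A = e ` S" by (simp add: A_def)
  have i: "?i x \<in> S" "?i x \<in> carrier N" if "x \<in> e ` S" for x
    using that S inv_into_into[of x e S] by auto
  have sdist: "sdist L A x y = (if x \<in> e ` S \<and> y \<in> e ` S then sdist L N (?i x) (?i y) else 0)" for x y
    using i by (auto simp: sdist_def A_def)
  interpret N: Metric_space "carrier N" "sdist L N"
    using N by (rule structure_metric)
  interpret A: Metric_space "e ` S" "sdist L A"
  proof
    show "0 \<le> sdist L A x y" for x y by (simp add: sdist)
    show "sdist L A x y = sdist L A y x" for x y by (simp add: sdist N.commute)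
    show "sdist L A x y = 0 \<longleftrightarrow> x = y" if "x \<in> e ` S" "y \<in> e ` S" for x y
      using that i N.zero inv_into_injective[of S e x y] by (auto simp: sdist)
    show "sdist L A x z \<le> sdist L A x y + sdist L A y z"
      if "x \<in> e ` S" "y \<in> e ` S" "z \<in> e ` S" for x y z
      using that i N.triangle by (simp add: sdist)
  qed
  have "compact_space A.mtopology"
    using S(1) by (simp add: compact_space_def finite_imp_compactin)
  then have complete: "A.mcomplete"
    by (rule A.compact_space_imp_mcomplete)
  have "\<exists>\<delta>>0. \<forall>xs \<in> tuples (arity L R) (e ` S). \<forall>ys \<in> tuples (arity L R) (e ` S).
      (\<forall>i<arity L R. sdist L A (xs ! i) (ys ! i) < \<delta>) \<longrightarrow> \<bar>interp A R xs - interp A R ys\<bar> < r"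
    if "r > 0" for R r
  proof -
    have "\<exists>\<delta>>0. \<forall>xs \<in> tuples (arity L R) (carrier N). \<forall>ys \<in> tuples (arity L R) (carrier N).
        (\<forall>i<arity L R. sdist L N (xs ! i) (ys ! i) < \<delta>) \<longrightarrow> \<bar>interp N R xs - interp N R ys\<bar> < r"
      using N that unfolding is_structure_def by simp
    then obtain \<delta> where \<delta>: "\<delta> > 0"
      "\<And>xs ys. xs \<in> tuples (arity L R) (carrier N) \<Longrightarrow> ys \<in> tuples (arity L R) (carrier N) \<Longrightarrow>
         \<forall>i<arity L R. sdist L N (xs ! i) (ys ! i) < \<delta> \<Longrightarrow>
         \<bar>interp N R xs - interp N R ys\<bar> < r"
      by blast
    show ?thesis
    proof (intro exI[of _ \<delta>] conjI ballI impI \<delta>(1))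
      fix xs ys assume xs: "xs \<in> tuples (arity L R) (e ` S)" and ys: "ys \<in> tuples (arity L R) (e ` S)"
        and near: "\<forall>i<arity L R. sdist L A (xs ! i) (ys ! i) < \<delta>"
      have tup: "map ?i xs \<in> tuples (arity L R) (carrier N)" "map ?i ys \<in> tuples (arity L R) (carrier N)"
        using xs ys i(2) unfolding tuples_def by force+
      have "sdist L N (map ?i xs ! j) (map ?i ys ! j) < \<delta>" if j: "j < arity L R" for j
      proof -
        have "xs ! j \<in> e ` S" "ys ! j \<in> e ` S"
          using j xs ys subsetD[of _ "e ` S", OF _ nth_mem] by (simp_all add: tuples_def)
        then show ?thesis
          using near j xs ys by (auto simp: sdist tuples_def)
      qed
      with tup have "\<bar>interp N R (map ?i xs) - interp N R (map ?i ys)\<bar> < r"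
        by (intro \<delta>(2)) auto
      then show "\<bar>interp A R xs - interp A R ys\<bar> < r" by (simp add: A_def)
    qed
  qed
  then show "is_structure L A"
    using A.Metric_space_axioms complete by (simp add: is_structure_def A)
  show "partial_iso L N A ((\<lambda>x. (x, e x)) ` S)"
    unfolding partial_iso_def
  proof (intro conjI allI ballI)
    show "(\<lambda>x. (x, e x)) ` S \<subseteq> carrier N \<times> carrier A" using S A by auto
    fix R ps assume "ps \<in> tuples (arity L R) ((\<lambda>x. (x, e x)) ` S)"
    then have "map fst ps = map ?i (map snd ps)"
      using S(3) by (auto simp: tuples_def)
    then show "interp N R (map fst ps) = interp A R (map snd ps)"
      by (simp add: A_def del: map_map)
  qed
qed

lemma member_structure:
  "class_of_finite_structures L K \<Longrightarrow> A \<in> K \<Longrightarrow> is_structure L A \<and> finite (carrier A)"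
  by (simp add: class_of_finite_structures_def)

lemma finite_copy_in_class:
  fixes N :: "('a, 'r) lstruct"
  assumes L: "is_language L" and N: "K_structure L K N" and S: "finite S" "S \<subseteq> carrier N"
  obtains A e where "A \<in> K" "carrier A = e ` S" "inj_on e S"
    "partial_iso L N A ((\<lambda>x. (x, e x)) ` S)"
proof -
  obtain e :: "'a \<Rightarrow> nat" where e: "inj_on e S"
    using S(1) finite_imp_inj_to_nat_seg by blast
  have N': "is_structure L N" using N by (simp add: K_structure_def)
  obtain A where A: "carrier A = e ` S" "is_structure L A" "partial_iso L N A ((\<lambda>x. (x, e x)) ` S)"
    using finite_copy[OF L N' S e] by blast
  have "Domain (((\<lambda>x. (x, e x)) ` S)\<inverse>) = carrier A" using A(1) by auto
  then obtain f where "is_embedding L A N f"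
    using partial_iso_total[OF L A(2) N' partial_iso_converse[OF A(3)]] by blast
  then have "A \<in> K"
    using N A(1,2) S(1) unfolding K_structure_def by (metis finite_imageI)
  then show ?thesis using A e that by blast
qed

section \<open>Enumerated structures and the bounded amalgamation property\<close>

text \<open>This turns the conditions on indices in the bounded amalgamation property into conditions on
  relations.\<close>

lemma same_enum_iff_partial_iso:
  assumes "set xs \<subseteq> carrier A" "set ys \<subseteq> carrier B" "length xs = length ys"
  shows "same_enum L (A, xs) (B, ys) \<longleftrightarrow> partial_iso L A B (set (zip xs ys))"
proof
  assume same: "same_enum L (A, xs) (B, ys)"
  show "partial_iso L A B (set (zip xs ys))"
    unfolding partial_iso_def
  proof (intro conjI allI ballI)
    show "set (zip xs ys) \<subseteq> carrier A \<times> carrier B"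
      using assms by (auto dest: set_zip_leftD set_zip_rightD)
    fix R ps assume ps: "ps \<in> tuples (arity L R) (set (zip xs ys))"
    have "\<forall>p\<in>set ps. \<exists>j. j < length xs \<and> p = (xs ! j, ys ! j)"
      using ps assms(3) unfolding tuples_def set_zip by fastforce
    then obtain \<iota> where \<iota>: "\<And>p. p \<in> set ps \<Longrightarrow> \<iota> p < length xs"
      "\<And>p. p \<in> set ps \<Longrightarrow> p = (xs ! \<iota> p, ys ! \<iota> p)" by metis
    have "map \<iota> ps \<in> tuples (arity L R) {..<length xs}"
      using ps \<iota>(1) by (auto simp: tuples_def)
    then have "interp A R (map ((!) xs) (map \<iota> ps)) = interp B R (map ((!) ys) (map \<iota> ps))"
      using same unfolding same_enum_def fst_conv snd_conv by blast
    moreover have maps: "map ((!) xs) (map \<iota> ps) = map fst ps" "map ((!) ys) (map \<iota> ps) = map snd ps"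
      using \<iota>(2) by (auto intro!: map_cong)
    ultimately show "interp A R (map fst ps) = interp B R (map snd ps)" by (simp only: maps)
  qed
next
  assume P: "partial_iso L A B (set (zip xs ys))"
  show "same_enum L (A, xs) (B, ys)"
    unfolding same_enum_def
  proof (intro conjI allI ballI)
    fix R js assume js: "js \<in> tuples (arity L R) {..<length (snd (A, xs))}"
    let ?ps = "map (\<lambda>j. (xs ! j, ys ! j)) js"
    have "?ps \<in> tuples (arity L R) (set (zip xs ys))"
      using js assms(3) by (auto simp: tuples_def set_zip subset_iff)
    then have "interp A R (map fst ?ps) = interp B R (map snd ?ps)"
      using P unfolding partial_iso_def by blast
    then show "interp (fst (A, xs)) R (map ((!) (snd (A, xs))) js) =
        interp (fst (B, ys)) R (map ((!) (snd (B, ys))) js)"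
      by (simp add: comp_def)
  qed (simp add: assms)
qed

lemma finite_arity_atMost: "is_language L \<Longrightarrow> finite {R. arity L R \<le> n}"
proof -
  assume "is_language L"
  then have "finite (\<Union>m\<le>n. {R. arity L R = m})"
    by (simp add: is_language_def)
  then show ?thesis by (rule rev_finite_subset) auto
qed

text \<open>The maximum in the definition of \<open>dinf\<close> is taken over a finite set because only finitely many
  predicates have arity at most the length of the tuple; without finiteness \<open>Max\<close> carries no
  information.\<close>

lemma dinf_finite:
  assumes "is_language L"
  shows "finite {\<bar>interp (fst a) R (nths (snd a) X) - interp (fst b) R (nths (snd b) X)\<bar> |R X.
     X \<subseteq> {..<length (snd a)} \<and> card X = arity L R}" (is "finite ?D")
proof -
  let ?n = "length (snd a)"
  have "?D \<subseteq> (\<lambda>(R, X). \<bar>interp (fst a) R (nths (snd a) X) - interp (fst b) R (nths (snd b) X)\<bar>) `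
      ({R. arity L R \<le> ?n} \<times> Pow {..<?n})"
  proof
    fix r assume "r \<in> ?D"
    then obtain R X where r: "r = \<bar>interp (fst a) R (nths (snd a) X) - interp (fst b) R (nths (snd b) X)\<bar>"
      and X: "X \<subseteq> {..<?n}" "card X = arity L R" by blast
    have "card X \<le> ?n" using card_mono[OF _ X(1)] by simp
    then show "r \<in> (\<lambda>(R, X). \<bar>interp (fst a) R (nths (snd a) X) - interp (fst b) R (nths (snd b) X)\<bar>) `
        ({R. arity L R \<le> ?n} \<times> Pow {..<?n})"
      using r X by (intro image_eqI[of _ _ "(R, X)"]) auto
  qed
  moreover have "finite ({R. arity L R \<le> ?n} \<times> Pow {..<?n})"
    using finite_arity_atMost[OF assms] by simp
  ultimately show ?thesis using finite_surj by blast
qed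

lemma dinf_nonneg: "is_language L \<Longrightarrow> 0 \<le> dinf L a b"
  unfolding dinf_def by (rule Max_ge) (use dinf_finite in auto)

lemma dinf_le:
  assumes "is_language L" "0 \<le> e"
    and "\<And>R X. X \<subseteq> {..<length (snd a)} \<Longrightarrow> card X = arity L R \<Longrightarrow>
      \<bar>interp (fst a) R (nths (snd a) X) - interp (fst b) R (nths (snd b) X)\<bar> \<le> e"
  shows "dinf L a b \<le> e"
  unfolding dinf_def using dinf_finite[OF assms(1)] assms(2,3) by (subst Max_le_iff) auto

text \<open>The bounded amalgamation property for a fixed length and constant, with \<open>n\<close> the length of the common
  part \<open>xs\<close>, \<open>ys\<close> (not of the extended tuples), and with partial isomorphisms in place of equality of
  enumerated structures.\<close>

definition bounded_amalgams :: "'r language \<Rightarrow> 'r fclass \<Rightarrow> nat \<Rightarrow> real \<Rightarrow> bool" where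
  "bounded_amalgams L K n c \<longleftrightarrow>
     (\<forall>A\<in>K. \<forall>B\<in>K. \<forall>xs w ys z. length xs = n \<and> length ys = n \<and>
        set (xs @ [w]) \<subseteq> carrier A \<and> set (ys @ [z]) \<subseteq> carrier B \<and>
        partial_iso L A B (set (zip xs ys)) \<longrightarrow>
        (\<exists>D\<in>K. \<exists>us w' z'. length us = n \<and> set (us @ [w', z']) \<subseteq> carrier D \<and>
          partial_iso L D A (set (zip (us @ [w']) (xs @ [w]))) \<and>
          partial_iso L D B (set (zip (us @ [z']) (ys @ [z]))) \<and>
          sdist L D w' z' \<le> c * dinf L (A, xs @ [w]) (B, ys @ [z])))"

lemma bounded_amalgamsE:
  assumes "bounded_amalgams L K n c" "A \<in> K" "B \<in> K" "length xs = n" "length ys = n"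
    "set (xs @ [w]) \<subseteq> carrier A" "set (ys @ [z]) \<subseteq> carrier B"
    "partial_iso L A B (set (zip xs ys))"
  obtains D us w' z' where "D \<in> K" "length us = n" "set (us @ [w', z']) \<subseteq> carrier D"
    "partial_iso L D A (set (zip (us @ [w']) (xs @ [w])))"
    "partial_iso L D B (set (zip (us @ [z']) (ys @ [z])))"
    "sdist L D w' z' \<le> c * dinf L (A, xs @ [w]) (B, ys @ [z])"
proof -
  have "\<exists>D\<in>K. \<exists>us w' z'. length us = n \<and> set (us @ [w', z']) \<subseteq> carrier D \<and>
      partial_iso L D A (set (zip (us @ [w']) (xs @ [w]))) \<and>
      partial_iso L D B (set (zip (us @ [z']) (ys @ [z]))) \<and>
      sdist L D w' z' \<le> c * dinf L (A, xs @ [w]) (B, ys @ [z])"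
    using assms(1)[unfolded bounded_amalgams_def, rule_format, OF assms(2,3), of xs ys w z] assms(4-8)
    by blast
  then show ?thesis using that by blast
qed

lemma bAP_bounded_amalgams:
  assumes L: "is_language L" and "bAP L K"
  obtains c where "c \<ge> 0" "bounded_amalgams L K n c"
proof -
  obtain c where c: "\<And>A xs w B ys z.
        (A, xs @ [w]) \<in> Kn K (Suc n) \<and> (B, ys @ [z]) \<in> Kn K (Suc n) \<and> same_enum L (A, xs) (B, ys) \<Longrightarrow>
        (\<exists>D us w' z'. (D, us @ [w', z']) \<in> Kn K (Suc n + 1) \<and>
           same_enum L (D, us @ [w']) (A, xs @ [w]) \<and>
           same_enum L (D, us @ [z']) (B, ys @ [z]) \<and>
           sdist L D w' z' \<le> c * dinf L (A, xs @ [w]) (B, ys @ [z]))"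
    using \<open>bAP L K\<close> unfolding bAP_def by meson
  show ?thesis
  \<comment> \<open>A negative constant may be replaced by 0 because \<open>dinf\<close> is nonnegative.\<close>
  proof (rule that[of "max c 0"], simp, unfold bounded_amalgams_def, intro ballI allI impI, elim conjE)
    fix A B xs w ys z
    assume A: "A \<in> K" "set (xs @ [w]) \<subseteq> carrier A" and B: "B \<in> K" "set (ys @ [z]) \<subseteq> carrier B"
      and len: "length xs = n" "length ys = n" and iso: "partial_iso L A B (set (zip xs ys))"
    have "same_enum L (A, xs) (B, ys)"
      using iso A B len by (subst same_enum_iff_partial_iso) auto
    then obtain D us w' z' where D: "(D, us @ [w', z']) \<in> Kn K (Suc n + 1)"
      "same_enum L (D, us @ [w']) (A, xs @ [w])" "same_enum L (D, us @ [z']) (B, ys @ [z])"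
      and dist: "sdist L D w' z' \<le> c * dinf L (A, xs @ [w]) (B, ys @ [z])"
      using c[of A xs w B ys z] A B len by (auto simp: Kn_def tuples_def)
    have "D \<in> K" "length us = n" and us: "set (us @ [w', z']) \<subseteq> carrier D"
      using D(1) by (auto simp: Kn_def tuples_def)
    moreover have "partial_iso L D A (set (zip (us @ [w']) (xs @ [w])))"
      using D(2) us A len \<open>length us = n\<close> by (subst same_enum_iff_partial_iso[symmetric]) auto
    moreover have "partial_iso L D B (set (zip (us @ [z']) (ys @ [z])))"
      using D(3) us B len \<open>length us = n\<close> by (subst same_enum_iff_partial_iso[symmetric]) auto
    moreover have "sdist L D w' z' \<le> max c 0 * dinf L (A, xs @ [w]) (B, ys @ [z])"
    proof -
      have "c * dinf L (A, xs @ [w]) (B, ys @ [z]) \<le> max c 0 * dinf L (A, xs @ [w]) (B, ys @ [z])"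
        using dinf_nonneg[OF L] by (intro mult_right_mono) auto
      then show ?thesis using dist by linarith
    qed
    ultimately show "\<exists>D\<in>K. \<exists>us w' z'. length us = n \<and> set (us @ [w', z']) \<subseteq> carrier D \<and>
        partial_iso L D A (set (zip (us @ [w']) (xs @ [w]))) \<and>
        partial_iso L D B (set (zip (us @ [z']) (ys @ [z]))) \<and>
        sdist L D w' z' \<le> max c 0 * dinf L (A, xs @ [w]) (B, ys @ [z])"
      by blast
  qed
qed

section \<open>Amalgamation\<close>

text \<open>The qualitative part of the bounded amalgamation property: \<open>w\<close> and \<open>z\<close> can be added to a common part
  simultaneously. The maps \<open>QA\<close> and \<open>QB\<close> into the amalgam need not be total.\<close>

lemma bAP_one_point_amalgam:
  assumes L: "is_language L" and K: "class_of_finite_structures L K" and "bAP L K"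
    and A: "A \<in> K" and B: "B \<in> K"
    and P: "finite P" "partial_iso L A B P" and w: "w \<in> carrier A" and z: "z \<in> carrier B"
  obtains D QA QB where "D \<in> K" "partial_iso L A D QA" "partial_iso L B D QB"
    "w \<in> Domain QA" "z \<in> Domain QB" "P \<subseteq> QA O QB\<inverse>"
proof -
  obtain ps where ps: "set ps = P" using finite_list[OF P(1)] by blast
  let ?xs = "map fst ps" and ?ys = "map snd ps" and ?n = "length ps"
  have zip: "zip ?xs ?ys = ps" by (simp add: zip_map_fst_snd)
  have car: "set ?xs \<subseteq> carrier A" "set ?ys \<subseteq> carrier B"
    using P(2) ps by (auto simp: partial_iso_def)
  obtain c where c: "bounded_amalgams L K ?n c"
    using bAP_bounded_amalgams[OF L \<open>bAP L K\<close>] by blast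
  have in_car: "set (?xs @ [w]) \<subseteq> carrier A" "set (?ys @ [z]) \<subseteq> carrier B"
    using car w z by auto
  have iso: "partial_iso L A B (set (zip ?xs ?ys))"
    using P(2) ps zip by simp
  obtain D us w' z' where "D \<in> K" and us: "length us = ?n"
    and DA: "partial_iso L D A (set (zip (us @ [w']) (?xs @ [w])))"
    and DB: "partial_iso L D B (set (zip (us @ [z']) (?ys @ [z])))"
    by (rule bounded_amalgamsE[OF c A B _ _ in_car iso]) auto
  show ?thesis
  proof
    show "D \<in> K" by fact
    show "partial_iso L A D ((set (zip (us @ [w']) (?xs @ [w])))\<inverse>)"
      using DA by (rule partial_iso_converse)
    show "partial_iso L B D ((set (zip (us @ [z']) (?ys @ [z])))\<inverse>)"
      using DB by (rule partial_iso_converse)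
    show "w \<in> Domain ((set (zip (us @ [w']) (?xs @ [w])))\<inverse>)"
      "z \<in> Domain ((set (zip (us @ [z']) (?ys @ [z])))\<inverse>)"
      using us by auto
    show "P \<subseteq> (set (zip (us @ [w']) (?xs @ [w])))\<inverse> O ((set (zip (us @ [z']) (?ys @ [z])))\<inverse>)\<inverse>"
    proof (rule subrelI)
      fix x y assume "(x, y) \<in> P"
      then obtain i where i: "i < ?n" "ps ! i = (x, y)"
        using ps by (metis in_set_conv_nth)
      then have "(us ! i, x) \<in> set (zip us ?xs)" "(us ! i, y) \<in> set (zip us ?ys)"
        using us by (auto simp: set_zip intro!: exI[of _ i])
      then show "(x, y) \<in> (set (zip (us @ [w']) (?xs @ [w])))\<inverse> O ((set (zip (us @ [z']) (?ys @ [z])))\<inverse>)\<inverse>"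
        using us by auto
    qed
  qed
qed

lemma partial_iso_finite:
  "partial_iso L A B P \<Longrightarrow> finite (carrier A) \<Longrightarrow> finite (carrier B) \<Longrightarrow> finite P"
  unfolding partial_iso_def by (blast intro: finite_subset finite_cartesian_product)

text \<open>One further point \<open>w\<close> of \<open>B\<close> is amalgamated with more and more points \<open>Y\<close> of \<open>C\<close>. In the induction step
  the one-point amalgam of \<open>w\<close> and \<open>y\<close> takes over the role of \<open>B\<close>, its image of \<open>w\<close> that of \<open>w\<close>, and its
  points coming from \<open>C\<close> form the new common part. The map \<open>T\<close> runs back to \<open>C\<close> because the points of \<open>C\<close>
  treated so far are a part of \<open>D\<close>.\<close>

lemma amalgamate_point_with_structure:
  assumes L: "is_language L" and K: "class_of_finite_structures L K" and bAP: "bAP L K"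
    and C: "C \<in> K" and Y: "finite Y" "Y \<subseteq> carrier C"
  shows "B \<in> K \<Longrightarrow> partial_iso L B C P \<Longrightarrow> w \<in> carrier B \<Longrightarrow>
    \<exists>D\<in>K. \<exists>Q T. partial_iso L B D Q \<and> partial_iso L D C T \<and> P \<subseteq> Q O T \<and> w \<in> Domain Q \<and> Y \<subseteq> Range T"
  using Y
proof (induction Y arbitrary: B P w rule: finite_induct)
  case empty
  have "P \<subseteq> Id_on (carrier B) O P"
    using partial_iso_carrier[OF empty.prems(2)] by auto
  moreover have "w \<in> Domain (Id_on (carrier B))" using empty.prems by auto
  ultimately show ?case
    using empty.prems(1,2) partial_iso_Id_on[of L B] by blast
next
  case (insert y Y)
  have "finite P"
    using partial_iso_finite[OF insert.prems(2)] member_structure[OF K] C insert.prems(1) by blast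
  then obtain D1 Q1 T1 where D1: "D1 \<in> K" "partial_iso L B D1 Q1" "partial_iso L C D1 T1"
    "w \<in> Domain Q1" "y \<in> Domain T1" "P \<subseteq> Q1 O T1\<inverse>"
    using bAP_one_point_amalgam[OF L K bAP insert.prems(1) C _ insert.prems(2,3), of y] insert.prems(4)
    by blast
  obtain w1 where w1: "(w, w1) \<in> Q1" using D1(4) by blast
  have w1_car: "w1 \<in> carrier D1" using partial_iso_carrier[OF D1(2) w1] by simp
  obtain D Q T where D: "D \<in> K" "partial_iso L D1 D Q" "partial_iso L D C T" "T1\<inverse> \<subseteq> Q O T"
    "w1 \<in> Domain Q" "Y \<subseteq> Range T"
    using insert.IH[OF D1(1) partial_iso_converse[OF D1(3)] w1_car] insert.prems(4) by auto
  have "P \<subseteq> (Q1 O Q) O T" using D1(6) D(4) by blast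
  moreover have "w \<in> Domain (Q1 O Q)" using w1 D(5) by blast
  moreover have "insert y Y \<subseteq> Range T" using D(4,6) D1(5) by blast
  ultimately show ?case using D(1,3) partial_iso_comp[OF D1(2) D(2)] by blast
qed

text \<open>The points of \<open>B\<close> are adjoined one at a time to extensions of \<open>C\<close>. Each step amalgamates the new point
  with the whole structure obtained so far, so that this structure embeds into the next one.\<close>

lemma amalgamate_structures:
  assumes L: "is_language L" and K: "class_of_finite_structures L K" and bAP: "bAP L K"
    and B: "B \<in> K" and C: "C \<in> K" and P: "partial_iso L B C P"
    and X: "finite X" "X \<subseteq> carrier B"
  shows "\<exists>D\<in>K. \<exists>E Q. partial_iso L C D E \<and> Domain E = carrier C \<and> partial_iso L B D Q \<and>
    X \<subseteq> Domain Q \<and> P O E \<subseteq> Q"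
  using X
proof (induction X rule: finite_induct)
  case empty
  have "P O Id_on (carrier C) \<subseteq> P" by auto
  then show ?case
    using C P partial_iso_Id_on[of L C] by (intro bexI[of _ C] exI[of _ "Id_on (carrier C)"] exI[of _ P]) auto
next
  case (insert w X)
  obtain D1 E1 Q1 where D1: "D1 \<in> K" "partial_iso L C D1 E1" "Domain E1 = carrier C"
    "partial_iso L B D1 Q1" "X \<subseteq> Domain Q1" "P O E1 \<subseteq> Q1"
    using insert.IH insert.prems by auto
  have w: "w \<in> carrier B" using insert.prems by simp
  have "finite (carrier D1)" using member_structure[OF K D1(1)] by simp
  then obtain D Q T where D: "D \<in> K" "partial_iso L B D Q" "partial_iso L D D1 T" "Q1 \<subseteq> Q O T"
    "w \<in> Domain Q" "carrier D1 \<subseteq> Range T"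
    using amalgamate_point_with_structure[OF L K bAP D1(1) _ subset_refl B D1(4) w] by blast
  \<comment> \<open>\<open>T O T\<inverse>\<close> is contained in the identity, which removes the detour through \<open>D1\<close>.\<close>
  have inj: "d = d'" if "(d, x) \<in> T" "(d', x) \<in> T" for d d' x
    using partial_iso_functional[OF L _ partial_iso_converse[OF D(3)], of x d d'] that
      member_structure[OF K] D(1) D1(1) by blast
  have "Domain (E1 O T\<inverse>) = carrier C"
    using D1(3) D(6) partial_iso_carrier[OF D1(2)] by blast
  moreover have "P O E1 O T\<inverse> \<subseteq> Q"
    using D1(6) D(4) inj by blast
  moreover have "insert w X \<subseteq> Domain Q"
    using D1(5) D(4,5) by blast
  ultimately show ?case
    using D(1,2) partial_iso_comp[OF D1(2) partial_iso_converse[OF D(3)]] by blast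
qed

text \<open>The common part of \<open>B\<close> and \<open>C\<close> is the set of pairs of images of a point of \<open>A\<close>.\<close>

lemma bAP_imp_AP:
  assumes L: "is_language L" and K: "class_of_finite_structures L K" and bAP: "bAP L K"
  shows "AP L K"
  unfolding AP_def
proof (intro ballI allI impI)
  fix A B C fB fC assume "A \<in> K" and B: "B \<in> K" and C: "C \<in> K"
    and f: "is_embedding L A B fB \<and> is_embedding L A C fC"
  define P where "P = ((\<lambda>x. (x, fB x)) ` carrier A)\<inverse> O (\<lambda>x. (x, fC x)) ` carrier A"
  have P: "partial_iso L B C P"
    unfolding P_def using f by (intro partial_iso_comp[of L B A] partial_iso_converse embedding_graph) auto
  obtain D E Q where D: "D \<in> K" "partial_iso L C D E" "Domain E = carrier C" "partial_iso L B D Q"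
    "carrier B \<subseteq> Domain Q" "P O E \<subseteq> Q"
    using amalgamate_structures[OF L K bAP B C P _ subset_refl] member_structure[OF K B] by blast
  have "Domain Q = carrier B"
    using D(5) partial_iso_carrier[OF D(4)] by blast
  have str: "is_structure L B" "is_structure L C" "is_structure L D"
    using member_structure[OF K] B C D(1) by auto
  obtain gB where gB: "\<forall>(x, y) \<in> Q. gB x = y" "is_embedding L B D gB"
    using partial_iso_total[OF L str(1,3) D(4) \<open>Domain Q = carrier B\<close>] by blast
  obtain gC where gC: "\<forall>(x, y) \<in> E. gC x = y" "is_embedding L C D gC"
    using partial_iso_total[OF L str(2,3) D(2,3)] by blast
  have "gB (fB x) = gC (fC x)" if "x \<in> carrier A" for x
  proof -
    have P: "(fB x, fC x) \<in> P" using that by (auto simp: P_def)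
    have "fC x \<in> carrier C" using that f by (auto simp: is_embedding_def)
    then obtain d where E: "(fC x, d) \<in> E" using D(3) by blast
    then have "(fB x, d) \<in> Q" using P D(6) by blast
    then show ?thesis using E gB(1) gC(1) by auto
  qed
  then show "\<exists>D\<in>K. \<exists>gB gC. is_embedding L B D gB \<and> is_embedding L C D gC \<and>
      (\<forall>x\<in>carrier A. gB (fB x) = gC (fC x))"
    using D(1) gB(2) gC(2) by blast
qed

section \<open>Types of tuples and moduli of continuity\<close>

lemma partial_iso_zip_comp:
  assumes "partial_iso L A B (set (zip xs ys))" "partial_iso L B C (set (zip ys zs))"
    and "length xs = length ys" "length ys = length zs"
  shows "partial_iso L A C (set (zip xs zs))"
  using partial_iso_comp[OF assms(1,2)]
proof (rule partial_iso_subset)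
  show "set (zip xs zs) \<subseteq> set (zip xs ys) O set (zip ys zs)"
    using assms(3,4) by (fastforce simp: set_zip)
qed

lemma partial_iso_zip_sym:
  assumes "partial_iso L A B (set (zip xs ys))"
  shows "partial_iso L B A (set (zip ys xs))"
  using partial_iso_converse[OF assms] by (rule partial_iso_subset) (auto simp: set_zip)

lemma partial_iso_zip_carrier:
  assumes P: "partial_iso L A B (set (zip xs ys))" and len: "length xs = length ys"
  shows "set xs \<subseteq> carrier A" "set ys \<subseteq> carrier B"
proof -
  have "map fst (zip xs ys) = xs" "map snd (zip xs ys) = ys" using len by simp_all
  then have "set xs = fst ` set (zip xs ys)" "set ys = snd ` set (zip xs ys)"
    by (metis list.set_map)+
  then show "set xs \<subseteq> carrier A" "set ys \<subseteq> carrier B"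
    using partial_iso_carrier[OF P] by auto
qed

lemma partial_iso_zip_embedding:
  assumes "is_embedding L A B f" "set xs \<subseteq> carrier A"
  shows "partial_iso L A B (set (zip xs (map f xs)))"
  using assms(1) by (rule embedding_partial_iso) (use assms(2) in \<open>auto simp: set_zip subset_iff\<close>)

lemma partial_iso_nths:
  assumes P: "partial_iso L A B (set (zip xs ys))" and len: "length xs = length ys"
    and X: "X \<subseteq> {..<length xs}" "card X = arity L R"
  shows "interp A R (nths xs X) = interp B R (nths ys X)"
proof -
  have "{i. i < length xs \<and> i \<in> X} = X" using X(1) by auto
  then have "nths (zip xs ys) X \<in> tuples (arity L R) (set (zip xs ys))"
    using X(2) len set_nths_subset[of "zip xs ys" X] by (simp add: tuples_def length_nths)
  then have "interp A R (map fst (nths (zip xs ys) X)) = interp B R (map snd (nths (zip xs ys) X))"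
    using P unfolding partial_iso_def by blast
  then show ?thesis
    using len by (simp add: nths_map[symmetric])
qed

text \<open>One \<open>\<delta>\<close> for all predicates of arity at most \<open>n\<close> simultaneously; there are finitely many of them.\<close>

definition modulus :: "'r language \<Rightarrow> ('a, 'r) lstruct \<Rightarrow> nat \<Rightarrow> real \<Rightarrow> real \<Rightarrow> bool" where
  "modulus L M n e \<delta> \<longleftrightarrow> (\<forall>R qs. arity L R \<le> n \<and> qs \<in> tuples (arity L R) (carrier M \<times> carrier M) \<and>
     (\<forall>(x, y) \<in> set qs. sdist L M x y < \<delta>) \<longrightarrow>
     \<bar>interp M R (map fst qs) - interp M R (map snd qs)\<bar> < e)"

lemma modulus_exists:
  assumes L: "is_language L" and M: "is_structure L M" and "e > 0"
  shows "\<exists>\<delta>>0. \<delta> \<le> e \<and> modulus L M n e \<delta>"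
proof -
  let ?good = "\<lambda>R \<delta>. \<forall>qs. qs \<in> tuples (arity L R) (carrier M \<times> carrier M) \<and>
      (\<forall>(x, y) \<in> set qs. sdist L M x y < \<delta>) \<longrightarrow>
      \<bar>interp M R (map fst qs) - interp M R (map snd qs)\<bar> < e"
  have "\<forall>R. \<exists>\<delta>>0. ?good R \<delta>"
  proof
    fix R
    obtain \<delta> where "\<delta> > 0"
      "\<And>qs. qs \<in> tuples (arity L R) (carrier M \<times> carrier M) \<Longrightarrow>
       (\<And>x y. (x, y) \<in> set qs \<Longrightarrow> sdist L M x y < \<delta>) \<Longrightarrow>
       \<bar>interp M R (map fst qs) - interp M R (map snd qs)\<bar> < e"
      using structure_uniformly_continuous[OF M \<open>e > 0\<close>, of R] by metis
    then show "\<exists>\<delta>>0. ?good R \<delta>" by (intro exI[of _ \<delta>]) auto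
  qed
  then obtain \<Delta> where \<Delta>: "\<And>R. \<Delta> R > 0" "\<And>R. ?good R (\<Delta> R)" by metis
  define \<delta> where "\<delta> = Min (insert e (\<Delta> ` {R. arity L R \<le> n}))"
  have fin: "finite (insert e (\<Delta> ` {R. arity L R \<le> n}))"
    using finite_arity_atMost[OF L] by simp
  have "\<delta> > 0" unfolding \<delta>_def using fin \<Delta>(1) \<open>e > 0\<close> by (subst Min_gr_iff) auto
  moreover have "\<delta> \<le> e" unfolding \<delta>_def using fin by (intro Min_le) auto
  moreover have "modulus L M n e \<delta>"
    unfolding modulus_def
  proof (intro allI impI, elim conjE)
    fix R qs assume R: "arity L R \<le> n" and qs: "qs \<in> tuples (arity L R) (carrier M \<times> carrier M)"
      and near: "\<forall>(x, y) \<in> set qs. sdist L M x y < \<delta>"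
    have "\<delta> \<le> \<Delta> R" unfolding \<delta>_def using fin R by (intro Min_le) auto
    then have "\<forall>(x, y) \<in> set qs. sdist L M x y < \<Delta> R" using near by fastforce
    then show "\<bar>interp M R (map fst qs) - interp M R (map snd qs)\<bar> < e"
      using \<Delta>(2) qs by blast
  qed
  ultimately show ?thesis by blast
qed

text \<open>The types of \<open>as\<close> and \<open>xs\<close> are realized in \<open>M\<close> by the nearby tuples \<open>hs\<close> and \<open>ms\<close>, hence \<open>dinf\<close> compares
  values of the predicates of \<open>M\<close> at nearby arguments.\<close>

lemma dinf_le_modulus:
  assumes L: "is_language L" and M: "is_structure L M" and "e > 0" and \<delta>: "modulus L M n e \<delta>"
    and len: "length as = n" "length hs = n" "length ms = n" "length xs = n"
    and A: "partial_iso L M A (set (zip hs as))" and B: "partial_iso L B M (set (zip xs ms))"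
    and near: "\<And>i. i < n \<Longrightarrow> sdist L M (hs ! i) (ms ! i) < \<delta>"
  shows "dinf L (A, as) (B, xs) \<le> e"
proof (rule dinf_le[OF L])
  show "0 \<le> e" using \<open>e > 0\<close> by simp
  fix R X assume "X \<subseteq> {..<length (snd (A, as))}" and cX: "card X = arity L R"
  then have X: "X \<subseteq> {..<n}" using len by simp
  have hs: "set hs \<subseteq> carrier M" and ms: "set ms \<subseteq> carrier M"
    using partial_iso_zip_carrier[OF A] partial_iso_zip_carrier[OF B] len by auto
  have XX: "{i. i < n \<and> i \<in> X} = X" using X by auto
  have "card X \<le> n" using card_mono[OF _ X] by simp
  let ?qs = "nths (zip hs ms) X"
  have sub: "set ?qs \<subseteq> set (zip hs ms)" by (rule set_nths_subset)
  have "?qs \<in> tuples (arity L R) (carrier M \<times> carrier M)"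
    using sub cX len XX hs ms by (force simp: tuples_def length_nths dest: set_zip_leftD set_zip_rightD)
  moreover have "\<forall>(x, y) \<in> set ?qs. sdist L M x y < \<delta>"
    using sub near len by (fastforce simp: set_zip)
  ultimately have "\<bar>interp M R (map fst ?qs) - interp M R (map snd ?qs)\<bar> < e"
    using \<delta> \<open>card X \<le> n\<close> cX unfolding modulus_def by simp
  moreover have "map fst ?qs = nths hs X" "map snd ?qs = nths ms X"
    using len by (simp_all add: nths_map[symmetric])
  moreover have "interp M R (nths hs X) = interp A R (nths as X)"
    using partial_iso_nths[OF A, of X R] X cX len by simp
  moreover have "interp B R (nths xs X) = interp M R (nths ms X)"
    using partial_iso_nths[OF B, of X R] X cX len by simp
  ultimately show "\<bar>interp (fst (A, as)) R (nths (snd (A, as)) X) -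
      interp (fst (B, xs)) R (nths (snd (B, xs)) X)\<bar> \<le> e"
    by simp
qed

section \<open>Exact one-point extensions in approximate limits\<close>

lemma tuple_dist_less:
  assumes "tuple_dist L D xs ys < e" "i < length xs"
  shows "sdist L D (xs ! i) (ys ! i) < e"
proof -
  have "{sdist L D (xs ! i) (ys ! i) |i. i < length xs} = (\<lambda>i. sdist L D (xs ! i) (ys ! i)) ` {..<length xs}"
    by auto
  then have "sdist L D (xs ! i) (ys ! i) \<le> tuple_dist L D xs ys"
    unfolding tuple_dist_def using assms(2) by (intro Max_ge) auto
  then show ?thesis using assms(1) by simp
qed

lemma approximate_limit_extension:
  assumes L: "is_language L" and K: "class_of_finite_structures L K" and HP: "HP L K"
    and M: "approximate_limit L K M" and B: "B \<in> K" and len: "length xs = length ys"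
    and P: "partial_iso L B M (set (zip xs ys))" and e: "e > 0"
  shows "\<exists>f. is_embedding L B M f \<and> (\<forall>i<length xs. sdist L M (f (xs ! i)) (ys ! i) < e)"
proof -
  have M': "is_structure L M"
    using M by (simp add: approximate_limit_def separable_K_structure_def K_structure_def)
  have B': "is_structure L B" "finite (carrier B)" "K_structure L K B"
    using member_structure[OF K B] HP B by (auto simp: HP_def)
  have dom: "Domain (set (zip xs ys)) = set xs"
    using len by (force simp: Domain_fst simp flip: list.set_map)
  obtain h where h: "\<forall>(x, y) \<in> set (zip xs ys). h x = y"
    and emb: "is_embedding L (induced B (Domain (set (zip xs ys)))) M h"
    using partial_iso_function[OF L B'(1) M' P] by blast
  have hi: "h (xs ! i) = ys ! i" if "i < length xs" for i
    using h that len by (auto simp: set_zip)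
  have xs: "set xs \<subseteq> carrier B"
    using P dom by (auto simp: partial_iso_def)
  have "enum_embedding L (B, xs) M h"
    using emb dom by (simp add: enum_embedding_def)
  then obtain f where f: "is_embedding L B M f" "tuple_dist L M (map f xs) (map h xs) < e"
    using M B' xs e unfolding approximate_limit_def by blast
  have "sdist L M (f (xs ! i)) (ys ! i) < e" if "i < length xs" for i
    using tuple_dist_less[OF f(2), of i] that hi by simp
  then show ?thesis using f(1) by blast
qed

text \<open>The heart of the argument. The tuple \<open>ms @ [u]\<close> realizes the type of \<open>xs @ [w]\<close> exactly, but over a base
  \<open>ms\<close> that is only close to \<open>hs\<close>. Hence the types of \<open>hs @ [u]\<close> and \<open>xs @ [w]\<close> over their common part are
  \<open>dinf\<close>-close, and the bounded amalgamation property adds to \<open>hs @ [u]\<close> a realization \<open>z'\<close> of the type of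
  \<open>w\<close> close to \<open>u\<close>. Mapping this amalgam to \<open>M\<close> by the approximate extension property moves \<open>hs\<close> and \<open>u\<close> as
  little as desired, whereas the distance from \<open>u\<close> to the new realization is controlled by the quality of the
  old approximation. This is what makes the iteration converge.\<close>

lemma improve_approximation:
  assumes L: "is_language L" and K: "class_of_finite_structures L K" and HP: "HP L K"
    and M: "approximate_limit L K M" and c: "c \<ge> 0" "bounded_amalgams L K n c"
    and B: "B \<in> K" "set (xs @ [w]) \<subseteq> carrier B"
    and len: "length xs = n" "length hs = n" "length ms = n"
    and hs: "partial_iso L B M (set (zip xs hs))"
    and ms: "partial_iso L B M (set (zip (xs @ [w]) (ms @ [u])))"
    and e: "e > 0" and \<delta>: "\<delta> > 0" "modulus L M (Suc n) e \<delta>"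
    and near: "\<And>i. i < n \<Longrightarrow> sdist L M (ms ! i) (hs ! i) < \<delta>" and "\<eta> > 0"
  shows "\<exists>ms' u'. length ms' = n \<and> partial_iso L B M (set (zip (xs @ [w]) (ms' @ [u']))) \<and>
    (\<forall>i<n. sdist L M (ms' ! i) (hs ! i) < \<eta>) \<and> sdist L M u u' \<le> c * e + \<eta>"
proof -
  have KM: "K_structure L K M"
    using M by (simp add: approximate_limit_def separable_K_structure_def)
  then have M': "is_structure L M" by (simp add: K_structure_def)
  interpret M: Metric_space "carrier M" "sdist L M"
    using M' by (rule structure_metric)
  have hsM: "set hs \<subseteq> carrier M"
    using partial_iso_zip_carrier[OF hs] len by auto
  have "(w, u) \<in> set (zip (xs @ [w]) (ms @ [u]))" using len by simp
  then have uM: "u \<in> carrier M" using partial_iso_carrier[OF ms] by blast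
  obtain A g where A: "A \<in> K" "carrier A = g ` set (hs @ [u])"
    and g: "partial_iso L M A ((\<lambda>x. (x, g x)) ` set (hs @ [u]))"
    by (rule finite_copy_in_class[OF L KM, of "set (hs @ [u])"]) (use hsM uM in auto)
  have MA: "partial_iso L M A (set (zip (hs @ [u]) (map g hs @ [g u])))"
    using g by (rule partial_iso_subset) (auto simp: set_zip len)
  have MA0: "partial_iso L M A (set (zip hs (map g hs)))"
    using MA by (rule partial_iso_subset) (simp add: subset_insertI)
  have AB: "partial_iso L A B (set (zip (map g hs) xs))"
    by (rule partial_iso_zip_comp[OF partial_iso_zip_sym[OF MA0] partial_iso_zip_sym[OF hs]])
      (simp_all add: len)
  have carA: "set (map g hs @ [g u]) \<subseteq> carrier A" using A(2) by auto
  obtain D us w' z' where D: "D \<in> K" "length us = n" "set (us @ [w', z']) \<subseteq> carrier D"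
    and DA: "partial_iso L D A (set (zip (us @ [w']) (map g hs @ [g u])))"
    and DB: "partial_iso L D B (set (zip (us @ [z']) (xs @ [w])))"
    and dist: "sdist L D w' z' \<le> c * dinf L (A, map g hs @ [g u]) (B, xs @ [w])"
    by (rule bounded_amalgamsE[OF c(2) A(1) B(1) _ len(1) carA B(2) AB]) (simp_all add: len)
  \<comment> \<open>The last entries of the two tuples in \<open>M\<close> are both \<open>u\<close>, so they are at distance 0.\<close>
  have "dinf L (A, map g hs @ [g u]) (B, xs @ [w]) \<le> e"
  proof (rule dinf_le_modulus[OF L M' e \<delta>(2) _ _ _ _ MA ms])
    show "sdist L M ((hs @ [u]) ! i) ((ms @ [u]) ! i) < \<delta>" if "i < Suc n" for i
      using near[of i] that len uM \<delta>(1) M.commute by (auto simp: nth_append less_Suc_eq)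
  qed (simp_all add: len)
  then have dist': "sdist L D w' z' \<le> c * e"
    using dist c(1) by (meson mult_left_mono order_trans)
  have DM: "partial_iso L D M (set (zip (us @ [w']) (hs @ [u])))"
    by (rule partial_iso_zip_comp[OF DA partial_iso_zip_sym[OF MA]]) (simp_all add: len D(2))
  have "length (us @ [w']) = length (hs @ [u])" by (simp add: len D(2))
  then obtain f where f: "is_embedding L D M f"
    and fnear: "\<forall>i<length (us @ [w']). sdist L M (f ((us @ [w']) ! i)) ((hs @ [u]) ! i) < \<eta>"
    using approximate_limit_extension[OF L K HP M D(1) _ DM \<open>\<eta> > 0\<close>] by blast
  have fM: "f w' \<in> carrier M" "f z' \<in> carrier M"
    using f D(3) by (auto simp: is_embedding_def)
  have "partial_iso L D M (set (zip (us @ [z']) (map f (us @ [z']))))"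
    using f by (rule partial_iso_zip_embedding) (use D(3) in auto)
  then have "partial_iso L B M (set (zip (xs @ [w]) (map f (us @ [z']))))"
    by (rule partial_iso_zip_comp[OF partial_iso_zip_sym[OF DB]]) (simp_all add: len D(2))
  moreover have "sdist L M (map f us ! i) (hs ! i) < \<eta>" if "i < n" for i
    using fnear[rule_format, of i] that len D(2) by (simp add: nth_append)
  moreover have "sdist L M u (f z') \<le> c * e + \<eta>"
  proof -
    have "sdist L M (f w') u < \<eta>"
      using fnear[rule_format, of n] len D(2) by (simp add: nth_append)
    moreover have "sdist L M (f w') (f z') = sdist L D w' z'"
      using partial_iso_dist[OF L embedding_graph[OF f], of w' "f w'" z' "f z'"] D(3) by auto
    ultimately show ?thesis
      using M.triangle[OF uM fM] M.commute[of u "f w'"] dist' by linarith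
  qed
  ultimately show ?thesis
    using D(2) by (intro exI[of _ "map f us"] exI[of _ "f z'"]) simp
qed

lemma (in Metric_space) MCauchy_geometric:
  assumes u: "\<And>n. u n \<in> M" and step: "\<And>n. d (u n) (u (Suc n)) \<le> C * (1/2)^n"
  shows "MCauchy u"
  unfolding MCauchy_def
proof (intro conjI allI impI)
  show "range u \<subseteq> M" using u by auto
  \<comment> \<open>Subtracting the tail of the geometric series makes the bound inductive.\<close>
  have far: "d (u n) (u (n + m)) \<le> 2 * C * (1/2)^n - 2 * C * (1/2)^(n + m)" for n m
  proof (induction m)
    case 0
    then show ?case using u by simp
  next
    case (Suc m)
    have "d (u n) (u (n + Suc m)) \<le> d (u n) (u (n + m)) + d (u (n + m)) (u (Suc (n + m)))"
      using triangle[OF u u u] by simp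
    also have "\<dots> \<le> 2 * C * (1/2)^n - 2 * C * (1/2)^(n + m) + C * (1/2)^(n + m)"
      using Suc.IH step[of "n + m"] by linarith
    finally show ?case by simp
  qed
  have "0 \<le> C" using order_trans[OF nonneg step[of 0]] by simp
  fix e :: real assume "e > 0"
  have "(\<lambda>n. 2 * C * (1/2)^n) \<longlonglongrightarrow> 2 * C * 0"
    by (intro tendsto_intros LIMSEQ_power_zero) simp
  then have "eventually (\<lambda>n. 2 * C * (1/2)^n < e / 2) sequentially"
    using \<open>e > 0\<close> by (intro order_tendstoD(2)[of _ "2 * C * 0"]) auto
  then obtain N where N: "2 * C * (1/2)^N < e / 2"
    by (auto simp: eventually_sequentially)
  have near: "d (u N) (u n) < e / 2" if "n \<ge> N" for n
  proof -
    have "0 \<le> 2 * C * (1/2)^n" using \<open>0 \<le> C\<close> by simp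
    then show ?thesis using far[of N "n - N"] that N by simp
  qed
  have "d (u n) (u n') < e" if "N \<le> n" "N \<le> n'" for n n'
    using triangle[OF u[of n] u[of N] u[of n']] commute[of "u n" "u N"] near[OF that(1)] near[OF that(2)] by simp
  then show "\<exists>N. \<forall>n n'. N \<le> n \<longrightarrow> N \<le> n' \<longrightarrow> d (u n) (u n') < e" by blast
qed

text \<open>Exact extension of finite partial isomorphisms by a single point, the hypothesis of back-and-forth.\<close>

definition one_point_extension :: "'r language \<Rightarrow> 'r fclass \<Rightarrow> ('a, 'r) lstruct \<Rightarrow> bool" where
  "one_point_extension L K M \<longleftrightarrow> (\<forall>B\<in>K. \<forall>P w. finite P \<and> partial_iso L B M P \<and> w \<in> carrier B \<longrightarrow>
     (\<exists>v. partial_iso L B M (insert (w, v) P)))"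

text \<open>Starting from the approximate extension property, \<open>improve_approximation\<close> is iterated with errors \<open>(1/2)^k\<close>. The
  realizations \<open>u k\<close> of the type of \<open>w\<close> form a Cauchy sequence while their bases converge to \<open>hs\<close>; the limit
  realizes the type of \<open>w\<close> over \<open>hs\<close> itself.\<close>

lemma approximate_limit_one_point_extension:
  assumes L: "is_language L" and K: "class_of_finite_structures L K" and HP: "HP L K"
    and bAP: "bAP L K" and M: "approximate_limit L K M"
  shows "one_point_extension L K M"
  unfolding one_point_extension_def
proof (intro ballI allI impI, elim conjE)
  fix B P w assume B: "B \<in> K" and P: "finite P" "partial_iso L B M P" and w: "w \<in> carrier B"
  have M': "is_structure L M"
    using M by (simp add: approximate_limit_def separable_K_structure_def K_structure_def)
  interpret M: Metric_space "carrier M" "sdist L M"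
    using M' by (rule structure_metric)
  have B': "is_structure L B" using member_structure[OF K B] by simp
  interpret B: Metric_space "carrier B" "sdist L B"
    using B' by (rule structure_metric)
  obtain ps where ps: "set ps = P" using finite_list[OF P(1)] by blast
  define n xs hs where "n = length ps" and "xs = map fst ps" and "hs = map snd ps"
  have len: "length xs = n" "length hs = n" and zip: "zip xs hs = ps"
    by (simp_all add: n_def xs_def hs_def zip_map_fst_snd)
  have hs: "partial_iso L B M (set (zip xs hs))" using P(2) ps zip by simp
  have xsw: "set (xs @ [w]) \<subseteq> carrier B" using P(2) ps w by (auto simp: xs_def partial_iso_def)
  obtain c where c: "c \<ge> 0" "bounded_amalgams L K n c"
    using bAP_bounded_amalgams[OF L bAP] by blast
  \<comment> \<open>The error \<open>(1/2)^k\<close> bounds both the change of the predicates and the distance of the bases.\<close>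
  have "\<forall>k. \<exists>\<delta>>0. \<delta> \<le> (1/2)^k \<and> modulus L M (Suc n) ((1/2)^k) \<delta>"
    using modulus_exists[OF L M'] by simp
  then obtain \<delta> where \<delta>: "\<And>k. \<delta> k > 0" "\<And>k. \<delta> k \<le> (1/2)^k"
    "\<And>k. modulus L M (Suc n) ((1/2)^k) (\<delta> k)" by metis
  \<comment> \<open>A stage consists of the base near \<open>hs\<close> and the realization of the type of \<open>w\<close>.\<close>
  let ?approx = "\<lambda>k s. length (fst s) = n \<and>
    partial_iso L B M (set (zip (xs @ [w]) (fst s @ [snd s]))) \<and>
    (\<forall>i<n. sdist L M (fst s ! i) (hs ! i) < \<delta> k)"
  have "\<exists>S. \<forall>k. ?approx k (S k) \<and>
      sdist L M (snd (S k)) (snd (S (Suc k))) \<le> c * (1/2)^k + \<delta> (Suc k)"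
  proof (rule dependent_nat_choice)
    obtain f where f: "is_embedding L B M f" "\<forall>i<length xs. sdist L M (f (xs ! i)) (hs ! i) < \<delta> 0"
      using approximate_limit_extension[OF L K HP M B _ hs \<delta>(1)] len by metis
    have "partial_iso L B M (set (zip (xs @ [w]) (map f (xs @ [w]))))"
      using f(1) xsw by (rule partial_iso_zip_embedding)
    then show "\<exists>s. ?approx 0 s"
      using f(2) len by (intro exI[of _ "(map f xs, f w)"]) simp
  next
    fix s k assume s: "?approx k s"
    then obtain ms' u' where "length ms' = n" "partial_iso L B M (set (zip (xs @ [w]) (ms' @ [u'])))"
      "\<forall>i<n. sdist L M (ms' ! i) (hs ! i) < \<delta> (Suc k)"
      "sdist L M (snd s) u' \<le> c * (1/2)^k + \<delta> (Suc k)"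
      using improve_approximation[OF L K HP M c B xsw len _ hs _ _ \<delta>(1) \<delta>(3)[of k] _ \<delta>(1)[of "Suc k"],
          of "fst s" "snd s"] by auto
    then show "\<exists>t. ?approx (Suc k) t \<and> sdist L M (snd s) (snd t) \<le> c * (1/2)^k + \<delta> (Suc k)"
      by (intro exI[of _ "(ms', u')"]) simp
  qed
  then obtain S where S: "\<And>k. ?approx k (S k)"
    and S_step: "\<And>k. sdist L M (snd (S k)) (snd (S (Suc k))) \<le> c * (1/2)^k + \<delta> (Suc k)"
    by blast
  define u where "u k = snd (S k)" for k
  define ms where "ms k = fst (S k)" for k
  have ms: "length (ms k) = n" "partial_iso L B M (set (zip (xs @ [w]) (ms k @ [u k])))"
    "\<And>i. i < n \<Longrightarrow> sdist L M (ms k ! i) (hs ! i) < \<delta> k" for k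
    using S[of k] by (auto simp: u_def ms_def)
  have uM: "u k \<in> carrier M" for k
  proof -
    have "(w, u k) \<in> set (zip (xs @ [w]) (ms k @ [u k]))" using len ms(1) by simp
    then show ?thesis using partial_iso_carrier[OF ms(2)[of k]] by blast
  qed
  have "M.MCauchy u"
  proof (rule M.MCauchy_geometric[OF uM])
    fix k
    have "\<delta> (Suc k) \<le> (1/2)^k" using \<delta>(1,2)[of "Suc k"] by simp
    then show "sdist L M (u k) (u (Suc k)) \<le> (c + 1) * (1/2)^k"
      using S_step[of k] unfolding u_def by (simp add: distrib_right)
  qed
  then obtain v where v: "limitin M.mtopology u v sequentially"
    using M' unfolding is_structure_def M.mcomplete_def by blast
  have vM: "v \<in> carrier M" using v M.limitin_mspace by blast
  have "partial_iso L B M (insert (w, v) P)"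
  proof (rule partial_iso_approx[OF B' M'])
    show PM: "insert (w, v) P \<subseteq> carrier B \<times> carrier M"
      using P(2) w vM by (auto simp: partial_iso_def)
    fix e :: real assume "e > 0"
    obtain N where N: "\<And>k. k \<ge> N \<Longrightarrow> sdist L M (u k) v < e"
      using v \<open>e > 0\<close> unfolding M.limit_metric_sequentially by blast
    obtain N' where N': "(1/2)^N' < e"
      using real_arch_pow_inv[OF \<open>e > 0\<close>, of "1/2"] by auto
    define k where "k = max N N'"
    have "\<delta> k < e"
    proof -
      have "(1/2::real)^k \<le> (1/2)^N'" unfolding k_def by (intro power_decreasing) auto
      then show ?thesis using \<delta>(2)[of k] N' by linarith
    qed
    have "\<exists>(a, b) \<in> set (zip (xs @ [w]) (ms k @ [u k])). sdist L B x a < e \<and> sdist L M y b < e"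
      if xy: "(x, y) \<in> insert (w, v) P" for x y
    proof (cases "(x, y) = (w, v)")
      case True
      have "(w, u k) \<in> set (zip (xs @ [w]) (ms k @ [u k]))" using len ms(1) by simp
      moreover have "sdist L M v (u k) < e" using N[of k] M.commute by (simp add: k_def)
      ultimately show ?thesis using True w \<open>e > 0\<close> by (intro bexI[of _ "(w, u k)"]) auto
    next
      case False
      then obtain i where i: "i < n" "x = xs ! i" "y = hs ! i"
        using xy ps unfolding n_def xs_def hs_def by (auto simp: in_set_conv_nth)
      have "(xs ! i, ms k ! i) \<in> set (zip (xs @ [w]) (ms k @ [u k]))"
        using i len ms(1) by (auto simp: set_zip)
      moreover have "sdist L M (hs ! i) (ms k ! i) < e"
        using ms(3)[OF i(1), of k] \<open>\<delta> k < e\<close> M.commute by simp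
      moreover have "xs ! i \<in> carrier B" using xsw i len by auto
      ultimately show ?thesis
        using i \<open>e > 0\<close> by (intro bexI[of _ "(xs ! i, ms k ! i)"]) auto
    qed
    then show "\<exists>P'. partial_iso L B M P' \<and> (\<forall>(x, y)\<in>insert (w, v) P.
        \<exists>(a, b)\<in>P'. sdist L B x a < e \<and> sdist L M y b < e)"
      using ms(2)[of k] by blast
  qed
  then show "\<exists>v. partial_iso L B M (insert (w, v) P)" by blast
qed

section \<open>Embeddings and isomorphisms of separable structures\<close>

text \<open>Only the finite part of \<open>N\<close> that consists of the domain and the new point matters, and it has a copy in the
  class.\<close>

lemma one_point_extension_K_structure:
  assumes L: "is_language L" and ext: "one_point_extension L K M" and N: "K_structure L K N"
    and P: "finite P" "partial_iso L N M P" and w: "w \<in> carrier N"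
  shows "\<exists>v. partial_iso L N M (insert (w, v) P)"
proof -
  let ?S = "insert w (Domain P)"
  have S: "finite ?S" "?S \<subseteq> carrier N"
    using P w by (auto simp: finite_Domain partial_iso_def)
  obtain A g where A: "A \<in> K" "carrier A = g ` ?S" "partial_iso L N A ((\<lambda>x. (x, g x)) ` ?S)"
    by (rule finite_copy_in_class[OF L N S])
  let ?G = "(\<lambda>x. (x, g x)) ` ?S"
  have "partial_iso L A M (?G\<inverse> O P)"
    by (rule partial_iso_comp[OF partial_iso_converse[OF A(3)] P(2)])
  moreover have "finite (?G\<inverse> O P)" using S(1) P(1) by (intro finite_relcomp) auto
  moreover have "g w \<in> carrier A" using A(2) by simp
  ultimately obtain v where v: "partial_iso L A M (insert (g w, v) (?G\<inverse> O P))"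
    using ext A(1) unfolding one_point_extension_def by blast
  have "partial_iso L N M (insert (w, v) P)"
    using partial_iso_comp[OF A(3) v]
    by (rule partial_iso_subset) auto
  then show ?thesis by blast
qed

lemma dense_in_superset:
  "dense_in L A C \<Longrightarrow> C \<subseteq> C' \<Longrightarrow> C' \<subseteq> carrier A \<Longrightarrow> dense_in L A C'"
  unfolding dense_in_def by blast

lemma extension_to_embedding:
  assumes L: "is_language L" and ext: "one_point_extension L K M" and M: "is_structure L M"
    and N: "separable_K_structure L K N" and P: "finite P" "partial_iso L N M P"
  shows "\<exists>f. is_embedding L N M f \<and> (\<forall>(x, y) \<in> P. f x = y)"
proof -
  have N': "is_structure L N" "is_separable L N" "K_structure L K N"
    using N by (auto simp: separable_K_structure_def K_structure_def)
  obtain C where C: "countable C" "dense_in L N C"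
    using separable_dense[OF N'(1,2)] by blast
  have CN: "x \<in> carrier N" if "x \<in> C" for x using C(2) that by (auto simp: dense_in_def)
  obtain Q where Q: "P \<subseteq> Q" "partial_iso L N M Q" "C \<subseteq> Domain Q"
  proof (rule back_and_forth[OF C(1) countable_empty P])
    show "\<exists>y. partial_iso L N M (insert (x, y) P')" if "finite P'" "partial_iso L N M P'" "x \<in> C" for P' x
      using one_point_extension_K_structure[OF L ext N'(3) that(1,2) CN[OF that(3)]] .
  qed auto
  have "Domain Q \<subseteq> carrier N" using Q(2) by (auto simp: partial_iso_def)
  then have dense: "dense_in L N (Domain Q)" using dense_in_superset[OF C(2) Q(3)] by simp
  obtain Q' where Q': "Q \<subseteq> Q'" "partial_iso L N M Q'" "Domain Q' = carrier N"
    by (rule partial_iso_completion[OF L N'(1) M Q(2)]) (use dense in blast)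
  obtain f where f: "\<forall>(x, y) \<in> Q'. f x = y" "is_embedding L N M f"
    using partial_iso_total[OF L N'(1) M Q'(2,3)] by blast
  have "f x = y" if "(x, y) \<in> P" for x y
  proof -
    have "(x, y) \<in> Q'" using that Q(1) Q'(1) by blast
    then show ?thesis using f(1) by auto
  qed
  then show ?thesis using f(2) by (intro exI[of _ f]) auto
qed

text \<open>Tasks are the points of dense countable subsets of both structures; the closure of the resulting partial
  isomorphism is total on both sides.\<close>

lemma extension_to_isomorphism:
  assumes L: "is_language L" and M: "separable_K_structure L K M" "one_point_extension L K M"
    and N: "separable_K_structure L K N" "one_point_extension L K N"
    and P: "finite P" "partial_iso L N M P"
  shows "\<exists>f. is_isomorphism L N M f \<and> (\<forall>(x, y) \<in> P. f x = y)"
proof -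
  have N': "is_structure L N" "is_separable L N" "K_structure L K N"
    and M': "is_structure L M" "is_separable L M" "K_structure L K M"
    using N M by (auto simp: separable_K_structure_def K_structure_def)
  obtain C where C: "countable C" "dense_in L N C"
    using separable_dense[OF N'(1,2)] by blast
  obtain C' where C': "countable C'" "dense_in L M C'"
    using separable_dense[OF M'(1,2)] by blast
  have CN: "x \<in> carrier N" if "x \<in> C" for x using C(2) that by (auto simp: dense_in_def)
  have CM: "x \<in> carrier M" if "x \<in> C'" for x using C'(2) that by (auto simp: dense_in_def)
  obtain Q where Q: "P \<subseteq> Q" "partial_iso L N M Q" "C \<subseteq> Domain Q" "C' \<subseteq> Range Q"
  proof (rule back_and_forth[OF C(1) C'(1) P])
    fix P' assume P': "finite P'" "partial_iso L N M P'"
    show "\<exists>y. partial_iso L N M (insert (x, y) P')" if "x \<in> C" for x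
      using one_point_extension_K_structure[OF L M(2) N'(3) P' CN[OF that]] .
    show "\<exists>x. partial_iso L N M (insert (x, y) P')" if y: "y \<in> C'" for y
    proof -
      have "finite (P'\<inverse>)" using P'(1) by simp
      then obtain x where x: "partial_iso L M N (insert (y, x) (P'\<inverse>))"
        using one_point_extension_K_structure[OF L N(2) M'(3) _ partial_iso_converse[OF P'(2)] CM[OF y]]
        by blast
      have "(insert (y, x) (P'\<inverse>))\<inverse> = insert (x, y) P'" by auto
      then show ?thesis using partial_iso_converse[OF x] by auto
    qed
  qed auto
  have "Domain Q \<subseteq> carrier N" "Range Q \<subseteq> carrier M" using Q(2) by (auto simp: partial_iso_def)
  then have dense: "dense_in L N (Domain Q)" "dense_in L M (Range Q)"
    using dense_in_superset[OF C(2) Q(3)] dense_in_superset[OF C'(2) Q(4)] by auto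
  obtain Q' where Q': "Q \<subseteq> Q'" "partial_iso L N M Q'" "Domain Q' = carrier N" "Range Q' = carrier M"
    by (rule partial_iso_completion[OF L N'(1) M'(1) Q(2)]) (use dense in blast)
  obtain f where f: "\<forall>(x, y) \<in> Q'. f x = y" "is_embedding L N M f"
    using partial_iso_total[OF L N'(1) M'(1) Q'(2,3)] by blast
  have "carrier M \<subseteq> f ` carrier N" 
  proof
    fix y assume "y \<in> carrier M"
    then obtain x where "(x, y) \<in> Q'" using Q'(4) by blast
    then show "y \<in> f ` carrier N" using f(1) Q'(3) by force
  qed
  then have "is_isomorphism L N M f"
    using f(2) by (auto simp: is_isomorphism_def is_embedding_def)
  moreover have "f x = y" if "(x, y) \<in> P" for x y
  proof -
    have "(x, y) \<in> Q'" using that Q(1) Q'(1) by blast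
    then show ?thesis using f(1) by auto
  qed
  ultimately show ?thesis by (intro exI[of _ f]) auto
qed

section \<open>Universal ultrahomogeneous structures\<close>

text \<open>The content is that nullary predicates have the same value in all structures of the class. By the joint
  embedding property this holds for the copies of the empty substructures.\<close>

lemma partial_iso_empty:
  assumes L: "is_language L" and JEP: "JEP L K" and M: "K_structure L K M" and N: "K_structure L K N"
  shows "partial_iso L M N {}"
proof -
  obtain A where A: "A \<in> K" "partial_iso L M A {}"
    by (rule finite_copy_in_class[OF L M, of "{}"]) auto
  obtain B where B: "B \<in> K" "partial_iso L N B {}"
    by (rule finite_copy_in_class[OF L N, of "{}"]) auto
  obtain C where "C \<in> K" "\<exists>f. is_embedding L A C f" "\<exists>g. is_embedding L B C g"
    using JEP A(1) B(1) unfolding JEP_def by blast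
  then obtain f g where C: "is_embedding L A C f" "is_embedding L B C g"
    by blast
  have AC: "partial_iso L A C {}" and BC: "partial_iso L B C {}"
    using embedding_partial_iso[OF C(1), of "{}"] embedding_partial_iso[OF C(2), of "{}"] by auto
  show ?thesis
    using partial_iso_comp[OF partial_iso_comp[OF partial_iso_comp[OF A(2) AC]
          partial_iso_converse[OF BC]] partial_iso_converse[OF B(2)]] by simp
qed

lemma embedding_comp:
  assumes "is_embedding L A B f" "is_embedding L B C g"
  shows "is_embedding L A C (g \<circ> f)"
proof -
  have "interp C R (map (g \<circ> f) xs) = interp A R xs" if xs: "xs \<in> tuples (arity L R) (carrier A)" for R xs
  proof -
    have "map f xs \<in> tuples (arity L R) (carrier B)"
      using xs assms(1) by (auto simp: tuples_def is_embedding_def)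
    then have "interp C R (map g (map f xs)) = interp B R (map f xs)"
      using assms(2) by (simp add: is_embedding_def del: map_map)
    then show ?thesis using assms(1) xs by (simp add: is_embedding_def)
  qed
  then show ?thesis using assms by (auto simp: is_embedding_def image_subset_iff)
qed

lemma finite_separable:
  assumes "is_structure L A" "finite (carrier A)"
  shows "is_separable L A"
proof -
  interpret Metric_space "carrier A" "sdist L A"
    using assms(1) by (rule structure_metric)
  show ?thesis
    unfolding is_separable_def separable_space_def
    using countable_finite[OF assms(2)] closure_of_topspace[of mtopology]
    by (intro exI[of _ "carrier A"]) simp
qed

text \<open>Universality is available for structures on real numbers, so a copy of \<open>B\<close> there is used.\<close>

lemma embedding_of_member:
  assumes L: "is_language L" and K: "class_of_finite_structures L K" and HP: "HP L K"
    and N: "universal TYPE(real) L K N" and B: "B \<in> K"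
  shows "\<exists>f. is_embedding L B N f"
proof -
  have B': "is_structure L B" "finite (carrier B)" "K_structure L K B"
    using member_structure[OF K B] HP B by (auto simp: HP_def)
  have "inj_on real (carrier B)" by (simp add: inj_on_def)
  obtain A :: "(real, 'a) lstruct" where A: "carrier A = real ` carrier B" "is_structure L A"
    "partial_iso L B A ((\<lambda>x. (x, real x)) ` carrier B)"
    by (rule finite_copy[OF L B'(1,2) subset_refl \<open>inj_on real (carrier B)\<close>])
  have "Domain ((\<lambda>x. (x, real x)) ` carrier B) = carrier B" by auto
  then obtain f where f: "is_embedding L B A f"
    using partial_iso_total[OF L B'(1) A(2,3)] by blast
  have "Domain (((\<lambda>x. (x, real x)) ` carrier B)\<inverse>) = carrier A" using A(1) by auto
  then obtain g where g: "is_embedding L A B g"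
    using partial_iso_total[OF L A(2) B'(1) partial_iso_converse[OF A(3)]] by blast
  have "K_structure L K A"
    unfolding K_structure_def
  proof (intro conjI A(2) allI impI, elim conjE exE)
    fix C :: "(nat, 'a) lstruct" and h
    assume "is_structure L C" "finite (carrier C)" "is_embedding L C A h"
    then show "C \<in> K"
      using B'(3) embedding_comp[of L C A h B g] g unfolding K_structure_def by auto
  qed
  moreover have "is_separable L A" using finite_separable[OF A(2)] A(1) B'(2) by simp
  ultimately obtain h where "is_embedding L A N h"
    using N unfolding universal_def separable_K_structure_def by blast
  then show ?thesis using embedding_comp[OF f] by blast
qed

text \<open>Universality embeds \<open>B\<close> into \<open>N\<close> somewhere. Ultrahomogeneity moves this copy by an automorphism so that it
  agrees with the given partial isomorphism on its domain; the image of \<open>w\<close> is then the required point.\<close>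

lemma ultrahomogeneous_universal_one_point_extension:
  assumes L: "is_language L" and K: "class_of_finite_structures L K" and HP: "HP L K"
    and N: "is_structure L N" "ultrahomogeneous L N" "universal TYPE(real) L K N"
  shows "one_point_extension L K N"
  unfolding one_point_extension_def
proof (intro ballI allI impI, elim conjE)
  fix B P w assume B: "B \<in> K" and P: "finite P" "partial_iso L B N P" and w: "w \<in> carrier B"
  obtain g where g: "is_embedding L B N g"
    using embedding_of_member[OF L K HP N(3) B] by blast
  let ?G = "(\<lambda>x. (x, g x)) ` carrier B"
  \<comment> \<open>The given map transported to the copy of \<open>B\<close> in \<open>N\<close>.\<close>
  let ?H = "?G\<inverse> O P"
  have H: "partial_iso L N N ?H"
    by (rule partial_iso_comp[OF partial_iso_converse[OF embedding_graph[OF g]] P(2)])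
  obtain f where f: "\<forall>(x, y) \<in> ?H. f x = y" "is_embedding L (induced N (Domain ?H)) N f"
    using partial_iso_function[OF L N(1,1) H] by blast
  have "finite (carrier B)" using member_structure[OF K B] by simp
  then have "finite (Domain ?H)" using P(1) by (intro finite_Domain finite_relcomp) auto
  moreover have "Domain ?H \<subseteq> carrier N" using H by (auto simp: partial_iso_def)
  ultimately obtain \<phi> where \<phi>: "is_automorphism L N \<phi>" "\<forall>x\<in>Domain ?H. \<phi> x = f x"
    using N(2) f(2) unfolding ultrahomogeneous_def by meson
  have "is_embedding L B N (\<phi> \<circ> g)"
    using \<phi>(1) g by (intro embedding_comp[of L B N]) (auto simp: is_isomorphism_def)
  moreover have "insert (w, (\<phi> \<circ> g) w) P \<subseteq> {(x, (\<phi> \<circ> g) x) |x. x \<in> carrier B}"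
  proof -
    have "x \<in> carrier B \<and> y = \<phi> (g x)" if "(x, y) \<in> P" for x y
    proof -
      have x: "x \<in> carrier B" using partial_iso_carrier[OF P(2) that] by simp
      then have H: "(g x, y) \<in> ?H" using that by auto
      then have "f (g x) = y" using bspec[OF f(1) H] by simp
      moreover have "\<phi> (g x) = f (g x)" using \<phi>(2) H by (rule bspec[OF _ DomainI])
      ultimately show ?thesis using x by simp
    qed
    then show ?thesis using w by auto
  qed
  ultimately show "\<exists>v. partial_iso L B N (insert (w, v) P)"
    by (intro exI[of _ "(\<phi> \<circ> g) w"] embedding_partial_iso)
qed

section \<open>Limits of classes with bounded amalgamation\<close>

theorem theorem15:
  fixes L :: "'r language" and K :: "'r fclass"
  assumes "is_language L"
    and "class_of_finite_structures L K"
    and "HP L K" and "JEP L K" and "bAP L K" and "PP L K" and "CP L K"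
  shows "Fraisse_class L K \<and>
    (\<forall>M :: ('m, 'r) lstruct. approximate_limit L K M \<longrightarrow>
       ultrahomogeneous L M \<and>
       exact_limit L K M \<and>
       universal TYPE('u) L K M \<and>
       (\<forall>N :: ('n, 'r) lstruct.
          separable_K_structure L K N \<and> ultrahomogeneous L N \<and> universal TYPE(real) L K N \<longrightarrow>
          (\<exists>f. is_isomorphism L M N f)))"
proof (intro conjI allI impI)
  note L = assms(1) and K = assms(2) and HP = assms(3) and JEP = assms(4) and bAP = assms(5)
  show "Fraisse_class L K"
    using bAP_imp_AP[OF L K bAP] assms by (simp add: Fraisse_class_def)
  fix M :: "('m, 'r) lstruct" assume lim: "approximate_limit L K M"
  have ext: "one_point_extension L K M"
    by (rule approximate_limit_one_point_extension[OF L K HP bAP lim])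
  have M: "separable_K_structure L K M" using lim by (simp add: approximate_limit_def)
  then have KM: "K_structure L K M" and M': "is_structure L M"
    by (auto simp: separable_K_structure_def K_structure_def)
  show "ultrahomogeneous L M"
    unfolding ultrahomogeneous_def
  proof (intro allI impI, elim conjE)
    fix S f assume S: "finite S" "S \<subseteq> carrier M" and f: "is_embedding L (induced M S) M f"
    have "finite ((\<lambda>x. (x, f x)) ` S)" using S(1) by simp
    then obtain g where "is_isomorphism L M M g" "\<forall>(x, y) \<in> (\<lambda>x. (x, f x)) ` S. g x = y"
      using extension_to_isomorphism[OF L M ext M ext _ partial_iso_graph[OF f S(2)]] by blast
    then show "\<exists>g. is_automorphism L M g \<and> (\<forall>x\<in>S. g x = f x)" by auto
  qed
  show "exact_limit L K M"
    unfolding exact_limit_def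
  proof (intro conjI M allI impI, elim conjE)
    fix B :: "(nat, 'r) lstruct" and xs h
    assume KB: "K_structure L K B" and fin: "finite (carrier B)" and xs: "set xs \<subseteq> carrier B"
      and h: "enum_embedding L (B, xs) M h"
    have "is_structure L B" using KB by (simp add: K_structure_def)
    then have "separable_K_structure L K B"
      using KB finite_separable[OF _ fin] by (simp add: separable_K_structure_def)
    moreover have "partial_iso L B M ((\<lambda>x. (x, h x)) ` set xs)"
      using h by (intro partial_iso_graph[OF _ xs]) (simp add: enum_embedding_def)
    moreover have "finite ((\<lambda>x. (x, h x)) ` set xs)" by simp
    ultimately have "\<exists>f. is_embedding L B M f \<and> (\<forall>(x, y) \<in> (\<lambda>x. (x, h x)) ` set xs. f x = y)"
      by (intro extension_to_embedding[OF L ext M'])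
    then show "\<exists>f. is_embedding L B M f \<and> (\<forall>x\<in>set xs. f x = h x)" by auto
  qed
  show "universal TYPE('u) L K M"
    unfolding universal_def
  proof (intro allI impI)
    fix N :: "('u, 'r) lstruct" assume N: "separable_K_structure L K N"
    then have "partial_iso L N M {}"
      using partial_iso_empty[OF L JEP _ KM, of N] by (simp add: separable_K_structure_def)
    then show "\<exists>f. is_embedding L N M f"
      using extension_to_embedding[OF L ext M' N] by blast
  qed
  fix N :: "('n, 'r) lstruct"
  assume N: "separable_K_structure L K N \<and> ultrahomogeneous L N \<and> universal TYPE(real) L K N"
  then have N': "separable_K_structure L K N" "is_structure L N" "K_structure L K N"
    by (auto simp: separable_K_structure_def K_structure_def)
  have "one_point_extension L K N"
    using ultrahomogeneous_universal_one_point_extension[OF L K HP N'(2)] N by simp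
  then show "\<exists>f. is_isomorphism L M N f"
    using extension_to_isomorphism[OF L N'(1) _ M ext _ partial_iso_empty[OF L JEP KM N'(3)]] by blast
qed

end
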